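(* In the setting described in the context, the sequence $(u_m)_{m\ge0}$ is almost surely not eventually constant. Moreover, for every realization in which $(u_m)_{m\ge0}$ is not eventually constant, the sequence $(z_m)_{m\ge0}$ converges in $\overline{\mathbb{H}}$ to some point $\zeta\in\overline{\mathbb{R}}$.
   Context: Let $\mathbb{H}=\{z\in\mathbb{C}:\operatorname{Im}z>0\}$ be the Poincaré upper half-plane (metric $(dx^2+dy^2)/y^2$), $\overline{\mathbb{R}}=\mathbb{R}\cup\{\infty\}$, and $\overline{\mathbb{H}}=\mathbb{H}\cup\overline{\mathbb{R}}$ (a closed disk). A (hyperbolic) line is a set $\{z\in\mathbb{H}:\operatorname{Re}z=x\}$ or $\{z\in\mathbb{H}:|z-x|=r\}$ with $x\in\mathbb{R}$, $r>0$; its reflection $t_L$ is $t_L(z)=2x-\bar z$, resp. $t_L(z)=r^2/(\bar z-x)+x$, extended continuously to $\overline{\mathbb{H}}$. Fix lines $L_1,L_2,L_3\subseteq\mathbb{H}$ and $z_0\in\mathbb{H}$ such that for all distinct $i,i'\in\{1,2,3\}$ either (a) $L_i\cap L_{i'}=\emptyset$ and $z_0$ lies in the connected component of $\mathbb{H}\setminus(L_i\cup L_{i'})$ whose boundary contains both lines, or (b) $L_i,L_{i'}$ meet at an angle of measure $\pi/m(i,i')$ with $m(i,i')\ge2$ an integer, and $z_0$ lies in the interior of that angle. Let $s_i=t_{L_i}$, let $W$ be the group generated by $S=\{s_1,s_2,s_3\}$ (a Coxeter system; $W$ is infinite and acts properly on $\mathbb{H}$), and let $\ell$ be the word length with respect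 to $S$. Let $i_1,i_2,\ldots$ be independent uniform random elements of $\{1,2,3\}$. Define $u_0=1$ and $u_{m+1}=u_m s_{i_{m+1}}$ if $\ell(u_ms_{i_{m+1}})>\ell(u_m)$, and $u_{m+1}=u_m$ otherwise (this is $u_m=s_{i_1}\star\cdots\star s_{i_m}$ for the Demazure product $\star$), and set $z_m=u_m(z_0)$. *)

theory Defs
  imports "HOL-Probability.Probability"
begin

definition upper :: "complex set" where
  "upper = {z. Im z > 0}"

datatype hline = Vert real | Circ real real

fun valid_line :: "hline \<Rightarrow> bool" where
  "valid_line (Vert x) = True"
| "valid_line (Circ x r) = (r > 0)"

fun line_set :: "hline \<Rightarrow> complex set" where
  "line_set (Vert x) = {z \<in> upper. Re z = x}"
| "line_set (Circ x r) = {z \<in> upper. cmod (z - complex_of_real x) = r}"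

fun refl :: "hline \<Rightarrow> complex \<Rightarrow> complex" where
  "refl (Vert x) z = 2 * complex_of_real x - cnj z"
| "refl (Circ x r) z = complex_of_real (r^2) / (cnj z - complex_of_real x) + complex_of_real x"

text \<open>A unit (Euclidean) tangent vector of the line at a point p on it; the other one is its negative.\<close>
fun line_tangent :: "hline \<Rightarrow> complex \<Rightarrow> complex" where
  "line_tangent (Vert x) p = \<i>"
| "line_tangent (Circ x r) p = \<i> * (p - complex_of_real x) / complex_of_real r"

definition cond_disjoint :: "hline \<Rightarrow> hline \<Rightarrow> complex \<Rightarrow> bool" where
  "cond_disjoint L L' z0 \<longleftrightarrow>
     line_set L \<inter> line_set L' = {} \<and>
     (\<exists>C \<in> components (upper - (line_set L \<union> line_set L')).
        z0 \<in> C \<and> line_set L \<subseteq> frontier C \<and> line_set L' \<subseteq> frontier C)"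

text \<open>Condition (b): the lines meet at a point p at an angle pi/m (m \<ge> 2 an integer) and z0 lies in
  the interior of that angle, i.e. in the component of the complement of the two lines which
  contains the initial part of the bisecting ray (direction d1 * cis(pi/(2m))) of the angle
  between unit tangent directions d1 (of L) and d2 (of L') with d2 = d1 * cis(pi/m), or the
  symmetric situation with the roles of d1 and d2 exchanged.  (Hyperbolic angles equal
  Euclidean angles since the metric is conformal.)\<close>
definition cond_angle :: "hline \<Rightarrow> hline \<Rightarrow> complex \<Rightarrow> bool" where
  "cond_angle L L' z0 \<longleftrightarrow>
     (\<exists>p (m::nat). m \<ge> 2 \<and> line_set L \<inter> line_set L' = {p} \<and>
       (\<exists>d1 \<in> {line_tangent L p, - line_tangent L p}.
        \<exists>d2 \<in> {line_tangent L' p, - line_tangent L' p}.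
          (d2 = d1 * cis (pi / real m) \<and>
             (\<forall>\<^sub>F \<epsilon> in at_right 0. p + complex_of_real \<epsilon> * d1 * cis (pi / (2 * real m))
                 \<in> connected_component_set (upper - (line_set L \<union> line_set L')) z0))
        \<or> (d1 = d2 * cis (pi / real m) \<and>
             (\<forall>\<^sub>F \<epsilon> in at_right 0. p + complex_of_real \<epsilon> * d2 * cis (pi / (2 * real m))
                 \<in> connected_component_set (upper - (line_set L \<union> line_set L')) z0))))"

fun act :: "(nat \<Rightarrow> hline) \<Rightarrow> nat list \<Rightarrow> complex \<Rightarrow> complex" where
  "act L [] z = z"
| "act L (a # w) z = refl (L a) (act L w z)"

text \<open>Two words represent the same group element iff they act identically on H.\<close>
definition same_elem :: "(nat \<Rightarrow> hline) \<Rightarrow> nat list \<Rightarrow> nat list \<Rightarrow> bool" where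
  "same_elem L w w' \<longleftrightarrow> (\<forall>z \<in> upper. act L w z = act L w' z)"

definition wlen :: "(nat \<Rightarrow> hline) \<Rightarrow> nat list \<Rightarrow> nat" where
  "wlen L w = (LEAST n. \<exists>w'. set w' \<subseteq> {1,2,3} \<and> length w' = n \<and> same_elem L w' w)"

fun demazure :: "(nat \<Rightarrow> hline) \<Rightarrow> (nat \<Rightarrow> nat) \<Rightarrow> nat \<Rightarrow> nat list" where
  "demazure L idx 0 = []"
| "demazure L idx (Suc m) =
     (if wlen L (demazure L idx m @ [idx (Suc m)]) > wlen L (demazure L idx m)
      then demazure L idx m @ [idx (Suc m)] else demazure L idx m)"

definition eventually_const_elem :: "(nat \<Rightarrow> hline) \<Rightarrow> (nat \<Rightarrow> nat list) \<Rightarrow> bool" where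
  "eventually_const_elem L u \<longleftrightarrow> (\<exists>N. \<forall>m \<ge> N. same_elem L (u m) (u N))"

text \<open>i_1, i_2, ... independent uniform on {1,2,3} (coordinate 0 unused).\<close>
definition index_space :: "(nat \<Rightarrow> nat) measure" where
  "index_space = (\<Pi>\<^sub>M k \<in> UNIV. measure_pmf (pmf_of_set {1,2,3::nat}))"

end

theory Submission
  imports Defs
begin

text \<open>
  In the hyperboloid model the three lines have outward unit normals \<open>r 1, r 2, r 3\<close> whose mutual
  Lorentz products are either at most \<open>-1\<close> or of the form \<open>- cos (\<pi>/m)\<close>. The argument of Tits with
  dihedral subgroups shows that \<open>\<ell> (w s\<^sub>i) > \<ell> w\<close> holds exactly when the root \<open>w (r i)\<close> points
  away from the base point.

  No \<open>w\<close> has all three generators as descents: some nonnegative combination of the \<open>r i\<close> is a causal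
  vector, and such a vector cannot change sign on the hyperboloid. Hence the process almost surely
  never stops.

  Along an infinite reduced word let \<open>\<gamma>\<^sub>k\<close> be the root of the wall crossed at step \<open>k\<close>. Two such walls
  are both crossed for good, so \<open>\<gamma>\<^sub>j + \<gamma>\<^sub>k\<close> is not causal and the product of \<open>\<gamma>\<^sub>j\<close> and \<open>\<gamma>\<^sub>k\<close> exceeds
  \<open>-1\<close>. Writing \<open>\<gamma>\<^sub>k = h\<^sub>k (1, p\<^sub>k)\<close>, this says \<open>\<bar>p\<^sub>j - p\<^sub>k\<bar> \<le> 1/h\<^sub>j + 1/h\<^sub>k\<close>. Discreteness of the orbit
  gives \<open>h\<^sub>k \<rightarrow> \<infinity>\<close>, so \<open>p\<^sub>k\<close> converges to a boundary point, and the orbit, which stays at bounded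
  distance from the walls being crossed, converges to the same point.
\<close>

section \<open>Lorentz geometry and reflection words\<close>

text \<open>The Minkowski form, time coordinate first. The hyperboloid sheet is
  \<open>lor v v = -1\<close>, \<open>fst v > 0\<close>; vectors of square 1 are normals of
  geodesics.\<close>

definition lor :: "real \<times> complex \<Rightarrow> real \<times> complex \<Rightarrow> real" where
  "lor u v = snd u \<bullet> snd v - fst u * fst v"

lemma lor_simps [simp]:
  "lor (u + u') v = lor u v + lor u' v"
  "lor v (u + u') = lor v u + lor v u'"
  "lor (u - u') v = lor u v - lor u' v"
  "lor v (u - u') = lor v u - lor v u'"
  "lor (c *\<^sub>R u) v = c * lor u v"
  "lor v (c *\<^sub>R u) = c * lor v u"
  "lor (- u) v = - lor u v"
  "lor v (- u) = - lor v u"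
  "lor v (1, 0) = - fst v"
  "lor (1, 0) v = - fst v"
  by (simp_all add: lor_def algebra_simps)

lemma lor_commute: "lor u v = lor v u"
  by (simp add: lor_def inner_commute mult.commute)

lemma lor_self: "lor u u = (norm (snd u))\<^sup>2 - (fst u)\<^sup>2"
  unfolding lor_def power2_norm_eq_inner by (simp add: power2_eq_square)

text \<open>Cauchy-Schwarz on the space parts, strict because a point of the sheet lies strictly
  inside the light cone. Hence a causal vector cannot separate points of the sheet.\<close>

lemma lor_causal_neg:
  assumes "lor d d \<le> 0" "fst d > 0" "lor v v = -1" "fst v > 0"
  shows "lor d v < 0"
proof -
  have d: "norm (snd d) \<le> fst d"
    by (rule power2_le_imp_le) (use assms(1,2) in \<open>auto simp: lor_self\<close>)
  have v: "norm (snd v) < fst v"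
    by (rule power2_less_imp_less) (use assms(3,4) in \<open>auto simp: lor_self\<close>)
  have "snd d \<bullet> snd v \<le> norm (snd d) * norm (snd v)"
    by (rule norm_cauchy_schwarz)
  also have "\<dots> \<le> fst d * norm (snd v)"
    using d by (simp add: mult_right_mono)
  also have "\<dots> < fst d * fst v"
    using v assms(2) by simp
  finally show ?thesis by (simp add: lor_def)
qed

definition reflv :: "real \<times> complex \<Rightarrow> real \<times> complex \<Rightarrow> real \<times> complex" where
  "reflv a v = v - (2 * lor v a) *\<^sub>R a"

lemma reflv_linear: "linear (reflv a)"
  by (rule linearI) (simp_all add: reflv_def algebra_simps)

lemma reflv_invol: "lor a a = 1 \<Longrightarrow> reflv a (reflv a v) = v"
  by (simp add: reflv_def algebra_simps)

lemma lor_reflv: "lor a a = 1 \<Longrightarrow> lor (reflv a u) (reflv a v) = lor u v"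
  by (simp add: reflv_def algebra_simps lor_commute)

text \<open>Otherwise the negative of the image lies on the upper sheet and has negative product
  with \<open>v\<close>; but that product is \<open>1 + 2 * (lor v a)^2\<close>.\<close>

lemma fst_reflv_pos:
  assumes "lor a a = 1" "lor v v = -1" "fst v > 0"
  shows "fst (reflv a v) > 0"
proof (rule ccontr)
  assume neg: "\<not> fst (reflv a v) > 0"
  have n: "lor (reflv a v) (reflv a v) = -1"
    using assms by (simp add: lor_reflv)
  then have "fst (reflv a v) \<noteq> 0"
    by (auto simp: lor_self) (smt (verit) zero_le_power2)
  with neg have "lor (- reflv a v) v < 0"
    using assms n by (intro lor_causal_neg) auto
  moreover have "lor (reflv a v) v = - 1 - 2 * (lor v a)\<^sup>2"
    using assms by (simp add: reflv_def power2_eq_square lor_commute[of a v])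
  ultimately show False by (smt (verit) lor_simps(7) zero_le_power2)
qed

section \<open>Words in reflections and their length\<close>

fun wact :: "(nat \<Rightarrow> real \<times> complex) \<Rightarrow> nat list \<Rightarrow> real \<times> complex \<Rightarrow> real \<times> complex" where
  "wact r [] v = v"
| "wact r (a # w) v = reflv (r a) (wact r w v)"

lemma wact_append [simp]: "wact r (w @ w') v = wact r w (wact r w' v)"
  by (induction w) auto

lemma wact_append_cong:
  "wact r v = wact r w \<Longrightarrow> wact r v' = wact r w' \<Longrightarrow> wact r (v @ v') = wact r (w @ w')"
  by auto

lemma wact_linear: "linear (wact r w)"
proof (induction w)
  case Nil
  then show ?case by (simp add: linear_iff)
next
  case (Cons a w)
  then show ?case
    using linear_compose[OF Cons reflv_linear[of "r a"]] by (simp add: o_def linear_iff)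
qed

lemmas wact_add = linear_add[OF wact_linear]
  and wact_diff = linear_diff[OF wact_linear]
  and wact_scale = linear_scale[OF wact_linear]
  and wact_neg = linear_neg[OF wact_linear]

locale unit_roots =
  fixes r :: "nat \<Rightarrow> real \<times> complex" and I :: "nat set"
  assumes unit: "i \<in> I \<Longrightarrow> lor (r i) (r i) = 1"
begin

lemma wact_rev [simp]:
  "set w \<subseteq> I \<Longrightarrow> wact r (rev w) (wact r w v) = v"
  by (induction w arbitrary: v) (auto simp: reflv_invol unit)

lemma wact_rev' [simp]: "set w \<subseteq> I \<Longrightarrow> wact r w (wact r (rev w) v) = v"
  using wact_rev[of "rev w"] by simp

lemma lor_wact: "set w \<subseteq> I \<Longrightarrow> lor (wact r w u) (wact r w v) = lor u v"
  by (induction w) (auto simp: lor_reflv unit)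

lemma lor_wact_rev: "set w \<subseteq> I \<Longrightarrow> lor (wact r w u) v = lor u (wact r (rev w) v)"
  using lor_wact[of w u "wact r (rev w) v"] by simp

lemma fst_wact_pos: "set w \<subseteq> I \<Longrightarrow> fst (wact r w (1, 0)) > 0"
proof (induction w)
  case (Cons a w)
  have "lor (wact r w (1,0)) (wact r w (1,0)) = -1"
    using Cons.prems by (subst lor_wact) auto
  then show ?case using Cons by (auto intro!: fst_reflv_pos unit)
qed simp

text \<open>Words are compared through their linear action, so this is word length in the linear
  reflection group; \<open>wlen_eq_len\<close> identifies it with \<open>wlen\<close>.\<close>

definition len :: "nat list \<Rightarrow> nat" where
  "len w = (LEAST n. \<exists>w'. set w' \<subseteq> I \<and> length w' = n \<and> wact r w' = wact r w)"

lemma len_witness: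
  assumes "set w \<subseteq> I"
  obtains w' where "set w' \<subseteq> I" "length w' = len w" "wact r w' = wact r w"
proof -
  have "\<exists>w'. set w' \<subseteq> I \<and> length w' = len w \<and> wact r w' = wact r w"
    unfolding len_def by (rule LeastI[of _ "length w"]) (use assms in blast)
  then show ?thesis using that by blast
qed

lemma len_le: "set w' \<subseteq> I \<Longrightarrow> wact r w' = wact r w \<Longrightarrow> len w \<le> length w'"
  unfolding len_def by (rule Least_le) blast

lemma len_cong: "wact r w' = wact r w \<Longrightarrow> len w' = len w"
  unfolding len_def by simp

lemma len_append_le:
  assumes "set w \<subseteq> I" "set w' \<subseteq> I"
  shows "len (w @ w') \<le> len w + len w'"
proof -
  obtain v v' where "set v \<subseteq> I" "length v = len w" "wact r v = wact r w"
    "set v' \<subseteq> I" "length v' = len w'" "wact r v' = wact r w'"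
    using len_witness assms by metis
  then show ?thesis
    using len_le[of "v @ v'" "w @ w'"] wact_append_cong[of r v w v' w'] by simp
qed

lemma len_le_length: "set w \<subseteq> I \<Longrightarrow> len w \<le> length w"
  by (rule len_le) auto

text \<open>Reversal inverts a word of involutions, so shortest words for an element and for its
  inverse correspond.\<close>

lemma len_rev:
  assumes "set w \<subseteq> I"
  shows "len (rev w) = len w"
proof -
  have le: "len (rev w) \<le> len w" if w: "set w \<subseteq> I" for w
  proof -
    obtain v where v: "set v \<subseteq> I" "length v = len w" "wact r v = wact r w"
      using len_witness w by metis
    have "wact r (rev v) x = wact r (rev w) x" for x
    proof -
      have "wact r (rev v) x = wact r (rev v) (wact r w (wact r (rev w) x))"
        using w by simp
      also have "\<dots> = wact r (rev v) (wact r v (wact r (rev w) x))"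
        using v by simp
      also have "\<dots> = wact r (rev w) x" by (rule wact_rev[OF v(1)])
      finally show ?thesis .
    qed
    then have "wact r (rev v) = wact r (rev w)" by auto
    then show ?thesis using len_le[of "rev v" "rev w"] v by simp
  qed
  show ?thesis using le[of w] le[of "rev w"] assms by simp
qed

end

section \<open>Roots and word length\<close>

text \<open>Positive \<open>fst (r i)\<close> means negative product with the base point
  \<open>(1, 0)\<close>, so \<open>r i\<close> points away from it. The two cases of
  \<open>gram\<close> come from disjoint lines and from lines meeting at angle
  \<open>pi / m\<close>.\<close>

locale chamber = unit_roots +
  assumes finI: "finite I"
    and outward: "i \<in> I \<Longrightarrow> fst (r i) > 0"
    and gram: "i \<in> I \<Longrightarrow> j \<in> I \<Longrightarrow> i \<noteq> j \<Longrightarrow>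
      lor (r i) (r j) \<le> -1 \<or> (\<exists>m::nat. m \<ge> 2 \<and> lor (r i) (r j) = - cos (pi / real m))"
begin

section \<open>Dihedral subgroups generated by two reflections\<close>

abbreviation (input) altw :: "nat \<Rightarrow> nat \<Rightarrow> nat \<Rightarrow> nat list" where
  "altw i t j \<equiv> concat (replicate j [i, t])"

lemma altw_snoc: "concat (replicate (Suc j) [i, t]) = altw i t j @ [i, t]"
  by (induction j) auto

lemma altw_swap: "t # altw i t j @ [i] = altw t i (Suc j)"
  by (induction j) auto

lemma set_altw: "set (altw i t j) \<subseteq> {i, t}"
  by (induction j) auto

lemma rev_altw: "rev (altw i t j) = altw t i j"
proof (induction j)
  case (Suc j)
  have "rev (altw i t (Suc j)) = rev (altw i t j) @ [t, i]" by simp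
  then show ?case using Suc altw_snoc[of j t i] by simp
qed simp

text \<open>In terms of \<open>r i\<close> and \<open>r t\<close>, each reflection replaces one
  coefficient by \<open>2 * c\<close> times the other minus itself. As \<open>c\<close> is at least
  1, the new coefficient is at least the other one, so the coefficients never decrease.\<close>

lemma altw_root_of_le_minus_one:
  assumes I: "i \<in> I" "t \<in> I" and c: "lor (r i) (r t) \<le> -1"
  shows "\<exists>a b. wact r (altw i t j) (r i) = a *\<^sub>R r i + b *\<^sub>R r t \<and> a \<ge> b \<and> b \<ge> 0 \<and> a > 0"
    and "\<exists>a b. wact r (t # altw i t j) (r i) = a *\<^sub>R r i + b *\<^sub>R r t \<and> b \<ge> a \<and> a > 0"
proof -
  define c where "c = - lor (r i) (r t)"
  have c1: "c \<ge> 1" and ti: "lor (r t) (r i) = - c" and it: "lor (r i) (r t) = - c"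
    using assms by (auto simp: c_def lor_commute)
  have st: "reflv (r t) (a *\<^sub>R r i + b *\<^sub>R r t) = a *\<^sub>R r i + (2 * c * a - b) *\<^sub>R r t" for a b
    using I by (simp add: reflv_def it unit algebra_simps flip: scaleR_2)
  have si: "reflv (r i) (a *\<^sub>R r i + b *\<^sub>R r t) = (2 * c * b - a) *\<^sub>R r i + b *\<^sub>R r t" for a b
    using I by (simp add: reflv_def ti unit algebra_simps flip: scaleR_2)
  have step: "2 * c * a - b \<ge> a" if "a \<ge> b" "a \<ge> 0" for a b :: real
    using mult_right_mono[OF c1, of a] that by linarith
  show main: "\<exists>a b. wact r (altw i t j) (r i) = a *\<^sub>R r i + b *\<^sub>R r t \<and> a \<ge> b \<and> b \<ge> 0 \<and> a > 0"
    for j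
  proof (induction j)
    case 0
    show ?case by (rule exI[of _ 1], rule exI[of _ 0]) simp
  next
    case (Suc j)
    then obtain a b where ab: "wact r (altw i t j) (r i) = a *\<^sub>R r i + b *\<^sub>R r t"
      "a \<ge> b" "b \<ge> 0" "a > 0" by blast
    define b' where "b' = 2 * c * a - b"
    have b': "b' \<ge> a" using step[of b a] ab by (simp add: b'_def)
    have a': "2 * c * b' - a \<ge> b'" using step[of a b'] ab b' by simp
    have "wact r (altw i t (Suc j)) (r i) = (2 * c * b' - a) *\<^sub>R r i + b' *\<^sub>R r t"
      using ab by (simp add: st si b'_def)
    then show ?case using a' b' ab by (intro exI[of _ "2 * c * b' - a"] exI[of _ b']) auto
  qed
  obtain a b where ab: "wact r (altw i t j) (r i) = a *\<^sub>R r i + b *\<^sub>R r t"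
      "a \<ge> b" "b \<ge> 0" "a > 0" using main by blast
  show "\<exists>a b. wact r (t # altw i t j) (r i) = a *\<^sub>R r i + b *\<^sub>R r t \<and> b \<ge> a \<and> a > 0"
    using ab step[of b a] by (intro exI[of _ a] exI[of _ "2 * c * a - b"]) (simp add: st)
qed

text \<open>The unit vector at angle \<open>\<phi>\<close> in the plane spanned by two roots, where
  \<open>r i\<close> has angle \<open>0\<close> and \<open>r t\<close> has angle \<open>\<pi> - \<theta>\<close>.\<close>
definition planar :: "nat \<Rightarrow> nat \<Rightarrow> real \<Rightarrow> real \<Rightarrow> real \<times> complex" where
  "planar i t \<theta> \<phi> = (sin (\<phi> + \<theta>) / sin \<theta>) *\<^sub>R r i + (sin \<phi> / sin \<theta>) *\<^sub>R r t"

text \<open>Both reflections reverse angles, sending \<open>r i\<close> from 0 to \<open>pi\<close>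
  and \<open>r t\<close> from \<open>pi - \<theta>\<close> to \<open>- \<theta>\<close>. Composed,
  they rotate by \<open>2 * \<theta>\<close>.\<close>

lemma planar_refl:
  assumes I: "i \<in> I" "t \<in> I" and c: "lor (r i) (r t) = - cos \<theta>" and s: "sin \<theta> \<noteq> 0"
  shows "reflv (r i) (planar i t \<theta> \<phi>) = planar i t \<theta> (pi - \<phi>)"
    and "reflv (r t) (planar i t \<theta> \<phi>) = planar i t \<theta> (pi - 2 * \<theta> - \<phi>)"
proof -
  have ti: "lor (r t) (r i) = - cos \<theta>" using c by (simp add: lor_commute)
  have e: "sin (pi - 2 * \<theta> - \<phi> + \<theta>) = sin (\<phi> + \<theta>)"
    using sin_pi_minus[of "\<phi> + \<theta>"] by (simp add: algebra_simps)
  have e1: "sin (pi - \<phi> + \<theta>) = sin (\<phi> - \<theta>)"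
    using sin_pi_minus[of "\<phi> - \<theta>"] by (simp add: algebra_simps)
  have e2: "sin (pi - 2 * \<theta> - \<phi>) = sin (\<phi> + 2 * \<theta>)"
    using sin_pi_minus[of "\<phi> + 2 * \<theta>"] by (simp add: algebra_simps)
  have e3: "sin (\<phi> - \<theta>) = 2 * cos \<theta> * sin \<phi> - sin (\<phi> + \<theta>)"
    by (simp add: sin_add sin_diff)
  have e4: "sin (\<phi> + 2 * \<theta>) = 2 * cos \<theta> * sin (\<phi> + \<theta>) - sin \<phi>"
  proof -
    have "sin ((\<phi> + \<theta>) + \<theta>) + sin ((\<phi> + \<theta>) - \<theta>) = 2 * cos \<theta> * sin (\<phi> + \<theta>)"
      by (simp only: sin_add[of "\<phi> + \<theta>" \<theta>] sin_diff[of "\<phi> + \<theta>" \<theta>]) simp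
    then show ?thesis by (simp add: algebra_simps)
  qed
  have st: "reflv (r t) (a *\<^sub>R r i + b *\<^sub>R r t) = a *\<^sub>R r i + (2 * cos \<theta> * a - b) *\<^sub>R r t" for a b
    using I by (simp add: reflv_def c unit algebra_simps flip: scaleR_2)
  have si: "reflv (r i) (a *\<^sub>R r i + b *\<^sub>R r t) = (2 * cos \<theta> * b - a) *\<^sub>R r i + b *\<^sub>R r t" for a b
    using I by (simp add: reflv_def ti unit algebra_simps flip: scaleR_2)
  show "reflv (r i) (planar i t \<theta> \<phi>) = planar i t \<theta> (pi - \<phi>)"
    unfolding planar_def si e1 e3 by (simp add: diff_divide_distrib)
  show "reflv (r t) (planar i t \<theta> \<phi>) = planar i t \<theta> (pi - 2 * \<theta> - \<phi>)"
    unfolding planar_def st e e2 e4 by (simp add: diff_divide_distrib)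
qed

lemma altw_planar:
  assumes I: "i \<in> I" "t \<in> I" and c: "lor (r i) (r t) = - cos \<theta>" and s: "sin \<theta> \<noteq> 0"
  shows "wact r (altw i t j) (planar i t \<theta> \<phi>) = planar i t \<theta> (\<phi> + 2 * real j * \<theta>)"
  by (induction j) (simp_all add: planar_refl[OF assms] algebra_simps)

text \<open>The \<open>m\<close>-th power of the rotation turns the plane of the two roots by
  \<open>2 * pi\<close>, and it fixes the Lorentz-orthogonal complement of that plane.\<close>

lemma altw_order:
  assumes I: "i \<in> I" "t \<in> I" and m: "m \<ge> 2" and c: "lor (r i) (r t) = - cos (pi / real m)"
  shows "wact r (altw i t m) v = v"
proof -
  define \<theta> where "\<theta> = pi / real m"
  have c': "lor (r i) (r t) = - cos \<theta>" using c by (simp add: \<theta>_def)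
  have "0 < \<theta>" "\<theta> < pi" using m by (auto simp: \<theta>_def field_simps)
  then have s: "sin \<theta> > 0" by (rule sin_gt_zero)
  have m\<theta>: "2 * real m * \<theta> = 2 * pi" using m by (simp add: \<theta>_def)
  have fix_planar: "wact r (altw i t m) (planar i t \<theta> \<phi>) = planar i t \<theta> \<phi>" for \<phi>
  proof -
    have "sin (\<phi> + 2 * pi + \<theta>) = sin (\<phi> + \<theta>)"
      using sin_periodic[of "\<phi> + \<theta>"] by (simp add: algebra_simps)
    then show ?thesis
      using altw_planar[OF I c', of m \<phi>] s by (simp add: m\<theta> planar_def)
  qed
  have pi0: "planar i t \<theta> 0 = r i" and pit: "planar i t \<theta> (pi - \<theta>) = r t"
    using s by (simp_all add: planar_def)
  \<comment> \<open>\<open>k\<close> is the Gram determinant of the two roots; \<open>x\<close> and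
    \<open>y\<close> solve the Gram system that makes \<open>p\<close> orthogonal to both.\<close>
  define k where "k = 1 - (cos \<theta>)\<^sup>2"
  have k: "k = (sin \<theta>)\<^sup>2" by (simp add: k_def sin_squared_eq)
  then have k0: "k \<noteq> 0" using s by simp
  define x where "x = (lor v (r i) + cos \<theta> * lor v (r t)) / k"
  define y where "y = (lor v (r t) + cos \<theta> * lor v (r i)) / k"
  define p where "p = v - x *\<^sub>R r i - y *\<^sub>R r t"
  have ti: "lor (r t) (r i) = - cos \<theta>" using c' by (simp add: lor_commute)
  have 1: "lor p (r i) = 0"
  proof -
    have "lor p (r i) = lor v (r i) - x + y * cos \<theta>"
      using I by (simp add: p_def unit ti)
    also have "k * \<dots> = 0" using k0 by (simp add: x_def y_def k_def field_simps power2_eq_square)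
    finally show ?thesis using k0 by simp
  qed
  have 2: "lor p (r t) = 0"
  proof -
    have "lor p (r t) = lor v (r t) + x * cos \<theta> - y"
      using I by (simp add: p_def unit c')
    also have "k * \<dots> = 0" using k0 by (simp add: x_def y_def k_def field_simps power2_eq_square)
    finally show ?thesis using k0 by simp
  qed
  have fix_p: "wact r (altw i t n) p = p" for n
    using 1 2 by (induction n) (auto simp: reflv_def)
  have v: "v = p + x *\<^sub>R r i + y *\<^sub>R r t" by (simp add: p_def)
  show ?thesis
    using fix_planar[of 0] fix_planar[of "pi - \<theta>"]
    by (simp add: v wact_add wact_scale fix_p pi0 pit)
qed

text \<open>Equal neighbouring letters would cancel, against minimality, so the letters alternate
  backwards from the final \<open>t\<close>.\<close>

lemma reduced_dihedral_word:
  assumes I: "i \<in> I" "t \<in> I" "i \<noteq> t" and x: "set x \<subseteq> {i, t}"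
    and min: "\<And>x'. set x' \<subseteq> {i, t} \<Longrightarrow> wact r x' = wact r x \<Longrightarrow> length x \<le> length x'"
    and last: "x \<noteq> [] \<Longrightarrow> last x = t"
  shows "\<exists>j. x = altw i t j \<or> x = t # altw i t j"
  using x min last
proof (induction x)
  case Nil
  show ?case by (rule exI[of _ 0]) simp
next
  case (Cons a x)
  have min': "length x \<le> length x'" if x': "set x' \<subseteq> {i, t}" "wact r x' = wact r x" for x'
  proof -
    have "wact r (a # x') = wact r (a # x)" using x' by auto
    then show ?thesis using Cons.prems(2)[of "a # x'"] Cons.prems(1) x' by auto
  qed
  have ne: "x \<noteq> a # x'" for x'
  proof
    assume "x = a # x'"
    moreover from this have "wact r (a # x) = wact r x'"
      using Cons.prems(1) I by (auto simp: reflv_invol unit)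
    ultimately show False using Cons.prems(1) Cons.prems(2)[of x'] by auto
  qed
  have last': "x \<noteq> [] \<Longrightarrow> last x = t" using Cons.prems(3) by auto
  have "set x \<subseteq> {i, t}" using Cons.prems(1) by simp
  from Cons.IH[OF this min' last'] obtain j where j: "x = altw i t j \<or> x = t # altw i t j"
    by blast
  from j show ?case
  proof
    assume x: "x = altw i t j"
    have "a = t"
    proof (cases j)
      case 0
      then show ?thesis using x Cons.prems(3) by simp
    next
      case (Suc k)
      then show ?thesis using x ne[of "t # altw i t k"] Cons.prems(1) by auto
    qed
    then show ?thesis using x by blast
  next
    assume x: "x = t # altw i t j"
    then have "a = i" using ne[of "altw i t j"] Cons.prems(1) by auto
    then have "a # x = altw i t (Suc j)" using x by simp
    then show ?thesis by blast
  qed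
qed

text \<open>By \<open>min_snoc\<close> the word cannot end in \<open>i\<close>, hence it is one of
  the alternating words, whose root is explicit. For products at most -1 the coefficients grow; for
  finite order \<open>m\<close> the length stays below \<open>m\<close>, which keeps the root in the
  sector between \<open>r i\<close> and \<open>r t\<close>.\<close>

lemma dihedral_root_nonneg:
  assumes I: "i \<in> I" "t \<in> I" "i \<noteq> t" and x: "set x \<subseteq> {i, t}"
    and min: "\<And>x'. set x' \<subseteq> {i, t} \<Longrightarrow> wact r x' = wact r x \<Longrightarrow> length x \<le> length x'"
    and min_snoc: "\<And>x'. set x' \<subseteq> {i, t} \<Longrightarrow> wact r x' = wact r (x @ [i]) \<Longrightarrow> length x \<le> length x'"
  shows "\<exists>a b. wact r x (r i) = a *\<^sub>R r i + b *\<^sub>R r t \<and> a \<ge> 0 \<and> b \<ge> 0 \<and> a + b > 0"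
proof -
  have last: "last x = t" if "x \<noteq> []"
  proof (rule ccontr)
    assume "last x \<noteq> t"
    then have "last x = i" using x last_in_set[OF that] by blast
    then have xs: "x = butlast x @ [i]" using that by (metis append_butlast_last_id)
    have "wact r (x @ [i]) = wact r (butlast x)"
      using I by (subst xs) (auto simp: reflv_invol unit)
    then have "length x \<le> length (butlast x)"
      using min_snoc[of "butlast x"] x by (auto dest: in_set_butlastD)
    moreover have "length (butlast x) < length x" using that by (cases x rule: rev_cases) auto
    ultimately show False by linarith
  qed
  have "\<exists>j. x = altw i t j \<or> x = t # altw i t j"
    by (rule reduced_dihedral_word[OF I x]) (fact min, fact last)
  then obtain j where j: "x = altw i t j \<or> x = t # altw i t j" by (elim exE)
  show ?thesis
  proof (cases "lor (r i) (r t) \<le> -1")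
    case 1: True
    obtain a b where "wact r (altw i t j) (r i) = a *\<^sub>R r i + b *\<^sub>R r t" "a \<ge> b" "b \<ge> 0" "a > 0"
      using altw_root_of_le_minus_one(1)[OF I(1,2) 1] by blast
    moreover obtain a' b' where "wact r (t # altw i t j) (r i) = a' *\<^sub>R r i + b' *\<^sub>R r t" "b' \<ge> a'" "a' > 0"
      using altw_root_of_le_minus_one(2)[OF I(1,2) 1] by blast
    moreover have "a + b > 0" "a' + b' > 0" "b' \<ge> 0" "a' \<ge> 0" "a \<ge> 0" using calculation by linarith+
    ultimately show ?thesis using j by blast
  next
    case False
    then obtain m :: nat where 2: "m \<ge> 2" "lor (r i) (r t) = - cos (pi / m)"
      using gram[OF I] by auto
    define \<theta> where "\<theta> = pi / real m"
    have c': "lor (r i) (r t) = - cos \<theta>" using 2 by (simp add: \<theta>_def)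
    have \<theta>: "0 < \<theta>" "\<theta> < pi" using 2 by (auto simp: \<theta>_def field_simps)
    then have s: "sin \<theta> > 0" by (intro sin_gt_zero)
    have ord: "wact r (altw i t m) v = v" "wact r (altw t i m) v = v" for v
      using altw_order[of i t m] altw_order[of t i m] I 2 by (auto simp: lor_commute)
    have lenw: "length (altw a b k) = 2 * k" for a b :: nat and k by (induction k) auto
    have split: "altw a b (k + l) = altw a b k @ altw a b l" for a b :: nat and k l
      by (simp add: replicate_add)
    have sub: "set (altw i t k) \<subseteq> I" for k using set_altw[of k i t] I by blast
    \<comment> \<open>Since the \<open>m\<close>-th power is trivial, the \<open>k\<close>-th power
      is the inverse of the power \<open>m - k\<close>, and inversion swaps the two letters.\<close>
    have inv: "wact r (altw i t k) = wact r (altw t i (m - k))" if "k \<le> m" for k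
    proof
      fix v
      have "altw i t m = altw i t (m - k) @ altw i t k" using split[of "m - k" k] that by simp
      then have "wact r (altw i t (m - k)) (wact r (altw i t k) v) = v" using ord(1)[of v] by simp
      then have "wact r (rev (altw i t (m - k))) v = wact r (altw i t k) v"
        using wact_rev[OF sub[of "m - k"], of "wact r (altw i t k) v"] by simp
      then show "wact r (altw i t k) v = wact r (altw t i (m - k)) v" by (simp add: rev_altw)
    qed
    \<comment> \<open>First a full period is cancelled to get \<open>j < m\<close>. Then, if
      \<open>x\<close> had length at least \<open>m\<close>, going round the relation the other way
      would write \<open>x @ [i]\<close> as a word shorter than \<open>x\<close>, against
      \<open>min_snoc\<close>.\<close>
    have jm: "length x < m"
    proof (rule ccontr)
      assume "\<not> length x < m"
      then have lm: "length x \<ge> m" by simp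
      have jlem: "j < m"
      proof (rule ccontr)
        assume "\<not> j < m"
        then have jj: "altw i t j = altw i t m @ altw i t (j - m)" using split[of m "j - m"] by simp
        from j show False
        proof
          assume "x = altw i t j"
          moreover from this have "wact r (altw i t (j - m)) = wact r x"
            using jj by (intro ext) (simp add: ord)
          ultimately show False
            using min[of "altw i t (j - m)"] set_altw[of "j - m" i t] \<open>\<not> j < m\<close> \<open>m \<ge> 2\<close>
            by (simp add: lenw)
        next
          assume "x = t # altw i t j"
          moreover from this have "wact r (t # altw i t (j - m)) = wact r x"
            using jj by (intro ext) (simp add: ord)
          ultimately show False
            using min[of "t # altw i t (j - m)"] set_altw[of "j - m" i t] \<open>\<not> j < m\<close> \<open>m \<ge> 2\<close>
            by (simp add: lenw)
        qed
      qed
      from j show False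
      proof
        assume xj: "x = altw i t j"
        \<comment> \<open>The appended \<open>i\<close> cancels the last letter of the complementary
          word of length \<open>2 * (m - j)\<close>, leaving the odd length
          \<open>2 * k + 1\<close>.\<close>
        obtain k where k: "m - j = Suc k" using jlem by (metis Suc_diff_Suc)
        have "wact r (x @ [i]) = wact r (altw t i k @ [t])"
        proof
          fix v
          have "wact r (x @ [i]) v = wact r (altw t i (Suc k)) (reflv (r i) v)"
            using inv[of j] jlem by (simp add: xj k)
          also have "\<dots> = wact r (altw t i k @ [t]) v"
            using I altw_snoc[of k t i] by (simp only: wact_append) (simp add: reflv_invol unit)
          finally show "wact r (x @ [i]) v = wact r (altw t i k @ [t]) v" .
        qed
        then have "length x \<le> 2 * k + 1"
          using min_snoc[of "altw t i k @ [t]"] set_altw[of k t i] by (auto simp: lenw)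
        then show False using xj lm k jlem by (simp add: lenw)
      next
        assume xj: "x = t # altw i t j"
        have "wact r (x @ [i]) = wact r (altw t i (Suc j))"
          using altw_swap[of t j i] xj by simp
        also have "\<dots> = wact r (rev (altw i t (Suc j)))" by (simp only: rev_altw)
        also have "\<dots> = wact r (altw i t (m - Suc j))"
        proof
          fix v
          have "wact r (altw i t (Suc j)) (wact r (altw i t (m - Suc j)) v) = v"
            using ord(1)[of v] split[of "Suc j" "m - Suc j"] jlem
            by (metis Suc_leI le_add_diff_inverse wact_append)
          then show "wact r (rev (altw i t (Suc j))) v = wact r (altw i t (m - Suc j)) v"
            using wact_rev[OF sub[of "Suc j"], of "wact r (altw i t (m - Suc j)) v"] by simp
        qed
        finally have "length x \<le> 2 * (m - Suc j)"
          using min_snoc[of "altw i t (m - Suc j)"] set_altw[of "m - Suc j" i t] by (auto simp: lenw)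
        then show False using xj lm jlem by (simp add: lenw)
      qed
    qed
    \<comment> \<open>The root has angle \<open>k * \<theta>\<close> or
      \<open>pi - (k + 1) * \<theta>\<close>; as \<open>(k + 1) * \<theta>\<close> is at most
      \<open>pi\<close>, both sines below are nonnegative.\<close>
    define k where "k = length x"
    have k\<theta>: "real (Suc k) * \<theta> \<le> pi"
    proof -
      have "real (Suc k) * \<theta> \<le> real m * \<theta>"
        using jm \<theta> by (intro mult_right_mono) (auto simp: k_def)
      then show ?thesis using 2 by (simp add: \<theta>_def)
    qed
    have sk: "sin (real k * \<theta>) \<ge> 0" "sin (real (Suc k) * \<theta>) \<ge> 0"
      using \<theta> k\<theta> by (auto intro!: sin_ge_zero simp: algebra_simps)
    have sum: "sin (real k * \<theta>) + sin (real (Suc k) * \<theta>) > 0"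
    proof (cases "k = 0")
      case True
      then show ?thesis using s by simp
    next
      case False
      then have "sin (real k * \<theta>) > 0"
        using \<theta> k\<theta> by (intro sin_gt_zero) (auto simp: algebra_simps)
      then show ?thesis using sk by linarith
    qed
    have p0: "planar i t \<theta> 0 = r i" using s by (simp add: planar_def)
    from j show ?thesis
    proof
      assume xj: "x = altw i t j"
      then have "wact r x (r i) = planar i t \<theta> (real k * \<theta>)"
        using altw_planar[OF I(1,2) c', of j 0] s p0 by (simp add: k_def lenw)
      then show ?thesis
        using sk sum s by (intro exI[of _ "sin (real k * \<theta> + \<theta>) / sin \<theta>"] exI[of _ "sin (real k * \<theta>) / sin \<theta>"])
          (auto simp: planar_def algebra_simps simp flip: add_divide_distrib)
    next
      assume xj: "x = t # altw i t j"
      then have "wact r x (r i) = planar i t \<theta> (pi - (real k * \<theta> + \<theta>))"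
        using altw_planar[OF I(1,2) c', of j 0] s p0 planar_refl(2)[OF I(1,2) c']
        by (simp add: k_def lenw algebra_simps)
      also have "\<dots> = (sin (real k * \<theta>) / sin \<theta>) *\<^sub>R r i + (sin (real k * \<theta> + \<theta>) / sin \<theta>) *\<^sub>R r t"
        using sin_pi_minus[of "real k * \<theta>"] sin_pi_minus[of "real k * \<theta> + \<theta>"]
        by (simp add: planar_def del: sin_pi_minus)
      finally show ?thesis
        using sk sum s by (intro exI[of _ "sin (real k * \<theta>) / sin \<theta>"] exI[of _ "sin (real k * \<theta> + \<theta>) / sin \<theta>"])
          (auto simp: algebra_simps simp flip: add_divide_distrib)
    qed
  qed
qed

section \<open>Descents and the sign of roots\<close>

text \<open>Induction on length. With \<open>t\<close> the last letter of a reduced word, split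
  \<open>w\<close> as \<open>v @ x\<close> with \<open>x\<close> in the letters \<open>i\<close>,
  \<open>t\<close>, lengths adding up and \<open>v\<close> shortest. Neither letter shortens
  \<open>v\<close>, so both roots are positive at \<open>v\<close>, and the dihedral case combines
  them nonnegatively. The weak hypothesis includes equal lengths; with
  \<open>descent_imp_root_neg\<close> this rules equality out without a parity argument.\<close>

lemma ascent_imp_root_pos:
  assumes "set w \<subseteq> I" "i \<in> I" "\<not> len (w @ [i]) < len w"
  shows "fst (wact r w (r i)) > 0"
  using assms
proof (induction "len w" arbitrary: w i rule: less_induct)
  case (less w i)
  obtain w' where w': "set w' \<subseteq> I" "length w' = len w" "wact r w' = wact r w"
    using len_witness less.prems by metis
  show ?case
  proof (cases w' rule: rev_cases)
    case Nil
    then have "wact r w = wact r []" using w' by simp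
    then show ?thesis using outward less.prems by simp
  next
    case (snoc w1 t)
    have t: "t \<in> I" "set w1 \<subseteq> I" using w' snoc by auto
    have lenw: "len w = Suc (length w1)" using w' snoc by simp
    have it: "i \<noteq> t"
    proof
      assume it: "i = t"
      have "wact r w1 = wact r (w @ [i])"
        using w' t it snoc by (auto simp: reflv_invol unit simp flip: w'(3))
      then have "len (w @ [i]) \<le> length w1" using len_le t by blast
      then show False using less.prems lenw by simp
    qed
    define P where "P v x \<longleftrightarrow> set v \<subseteq> I \<and> set x \<subseteq> {i, t} \<and> wact r (v @ x) = wact r w \<and> len v + length x = len w"
      for v x
    have len_split: "len w \<le> len v + length x'"
      if "set v \<subseteq> I" "set x' \<subseteq> {i, t}" "wact r (v @ x') = wact r w" for v x'
    proof -
      have x': "set x' \<subseteq> I" using that less.prems t by auto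
      show ?thesis
        using len_append_le[of v x'] len_le_length[of x'] len_cong[OF that(3)] that x' by linarith
    qed
    have "len w1 \<le> length w1" using t by (intro len_le_length)
    \<comment> \<open>This admissible splitting guarantees that the minimal \<open>v\<close> is
      strictly shorter than \<open>w\<close>, as the induction requires.\<close>
    then have "P w1 [t]"
      using t w' snoc lenw len_split[of w1 "[t]"] by (auto simp: P_def)
    then obtain v x where vx: "P v x" and vmin: "\<And>v' x'. P v' x' \<Longrightarrow> len v \<le> len v'"
      using exists_least_iff[of "\<lambda>n. \<exists>v x. P v x \<and> len v = n"] by (metis not_le)
    have v: "set v \<subseteq> I" "set x \<subseteq> {i, t}" "wact r (v @ x) = wact r w" "len v + length x = len w"
      using vx by (auto simp: P_def)
    have lv: "len v < len w"
      using vmin[OF \<open>P w1 [t]\<close>] \<open>len w1 \<le> length w1\<close> lenw by simp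
    \<comment> \<open>If \<open>a\<close> shortened \<open>v\<close>, moving it across to
      \<open>a # x\<close> would give an admissible splitting with a shorter first factor.\<close>
    have asc: "\<not> len (v @ [a]) < len v" if a: "a \<in> {i, t}" for a
    proof
      assume lt: "len (v @ [a]) < len v"
      have aI: "a \<in> I" using a less.prems t by auto
      have eq: "wact r ((v @ [a]) @ a # x) = wact r w"
        using v(3) aI by (auto simp: reflv_invol unit fun_eq_iff)
      have "len w \<le> len (v @ [a]) + length (a # x)"
        using v a aI eq by (intro len_split) auto
      then have "P (v @ [a]) (a # x)"
        using v a aI eq lt by (auto simp: P_def simp del: append.simps)
      then show False using vmin lt by fastforce
    qed
    have pos: "fst (wact r v (r i)) > 0" "fst (wact r v (r t)) > 0"
      using less.hyps[OF lv v(1)] asc less.prems t by auto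
    have min: "length x \<le> length x'" if "set x' \<subseteq> {i, t}" "wact r x' = wact r x" for x'
    proof -
      have "wact r (v @ x') = wact r w" using that v(3) by (auto simp: fun_eq_iff)
      then show ?thesis using len_split[OF v(1) that(1)] v(4) by simp
    qed
    have min_snoc: "length x \<le> length x'" if "set x' \<subseteq> {i, t}" "wact r x' = wact r (x @ [i])" for x'
    proof -
      have "wact r (v @ x') = wact r ((v @ x) @ [i])"
        using wact_append_cong[OF _ that(2), of v v] by simp
      also have "\<dots> = wact r (w @ [i])"
        using wact_append_cong[OF v(3), of "[i]" "[i]"] by simp
      finally have "wact r (v @ x') = wact r (w @ [i])" .
      then have "len (w @ [i]) = len (v @ x')" by (rule len_cong[symmetric])
      moreover have "set x' \<subseteq> I" using that less.prems t by auto
      ultimately have "len (w @ [i]) \<le> len v + length x'"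
        using len_append_le[OF v(1), of x'] len_le_length[of x'] by linarith
      then show ?thesis using less.prems(3) v(4) by linarith
    qed
    obtain a b where ab: "wact r x (r i) = a *\<^sub>R r i + b *\<^sub>R r t" "a \<ge> 0" "b \<ge> 0" "a + b > 0"
      using dihedral_root_nonneg[OF less.prems(2) t(1) it v(2) min min_snoc] by blast
    have "wact r w (r i) = wact r v (wact r x (r i))" using v(3) by (metis wact_append)
    then have "fst (wact r w (r i)) = a * fst (wact r v (r i)) + b * fst (wact r v (r t))"
      by (simp add: ab wact_add wact_scale)
    also have "\<dots> > 0"
      using pos ab by (cases "a = 0") (auto intro: add_pos_nonneg)
    finally show ?thesis .
  qed
qed

text \<open>Appending \<open>i\<close> twice gives back \<open>w\<close>, so the ascent case applies
  to \<open>w @ [i]\<close>; the reflection negates its own root.\<close>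

lemma descent_imp_root_neg:
  assumes "set w \<subseteq> I" "i \<in> I" "\<not> len (w @ [i]) > len w"
  shows "fst (wact r w (r i)) < 0"
proof -
  have "len ((w @ [i]) @ [i]) = len w" using assms by (intro len_cong) (auto simp: reflv_invol unit)
  then have "fst (wact r (w @ [i]) (r i)) > 0"
    using assms by (intro ascent_imp_root_pos) auto
  moreover have "reflv (r i) (r i) = - r i"
    using assms unit[of i] by (simp add: reflv_def scaleR_2)
  ultimately show ?thesis by (simp add: wact_neg)
qed

end

section \<open>Infinite reduced words\<close>

lemma norm_prod_sq: "(norm u)\<^sup>2 = (fst u)\<^sup>2 + (norm (snd u))\<^sup>2" for u :: "real \<times> complex"
  by (cases u) (simp add: norm_Pair)

context chamber
begin

text \<open>The first letter \<open>i\<close> of a reduced word is a left descent, so the wall of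
  \<open>r i\<close> separates the base point from its image. A point beyond that wall is at least
  as far away as the wall itself, which Cauchy-Schwarz quantifies.\<close>

lemma orbit_point_far:
  assumes "set w \<subseteq> I" "wact r w (1, 0) \<noteq> (1, 0)"
  shows "\<exists>i\<in>I. (fst (wact r w (1, 0)))\<^sup>2 > 1 + (fst (r i))\<^sup>2"
proof -
  obtain w' where w': "set w' \<subseteq> I" "length w' = len w" "wact r w' = wact r w"
    using len_witness assms by metis
  have "w' \<noteq> []" using w'(3) assms(2) by (metis wact.simps(1))
  then obtain i w1 where iw: "w' = i # w1" by (cases w') auto
  then have i: "i \<in> I" "set w1 \<subseteq> I" using w' by auto
  have "wact r w1 = wact r (i # w)"
    using w'(3) i iw by (auto simp: reflv_invol unit simp flip: w'(3))
  then have "len (i # w) < len w"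
    using len_le[of w1 "i # w"] i w' iw by simp
  \<comment> \<open>Descents are tested on the right, hence the passage to the inverse.\<close>
  moreover have "len (rev w @ [i]) = len (i # w)" "len (rev w) = len w"
    using len_rev[of "i # w"] len_rev[of w] i assms by auto
  ultimately have "fst (wact r (rev w) (r i)) < 0"
    using assms i by (intro descent_imp_root_neg) auto
  then have "lor (wact r (rev w) (r i)) (1, 0) > 0" by simp
  moreover define y where "y = wact r w (1, 0)"
  ultimately have pos: "lor (r i) y > 0"
    using assms lor_wact_rev[of "rev w" "r i" "(1,0)"] by simp
  have y: "lor y y = -1" "fst y > 0"
    using assms lor_wact[of w] fst_wact_pos by (auto simp: y_def)
  define c h where "c = fst (r i)" and "h = fst y"
  have c: "c > 0" using i by (simp add: c_def outward)
  have "0 < c * h" using c y by (simp add: h_def)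
  moreover have "c * h < norm (snd (r i)) * norm (snd y)"
    using pos norm_cauchy_schwarz[of "snd (r i)" "snd y"] by (simp add: lor_def c_def h_def)
  ultimately have "(c * h)\<^sup>2 < (norm (snd (r i)) * norm (snd y))\<^sup>2"
    by (intro power_strict_mono) auto
  also have "\<dots> = (1 + c\<^sup>2) * (h\<^sup>2 - 1)"
  proof -
    have "(norm (snd (r i)))\<^sup>2 = 1 + c\<^sup>2" "(norm (snd y))\<^sup>2 = h\<^sup>2 - 1"
      using unit[OF i(1)] y by (simp_all add: lor_self c_def h_def)
    then show ?thesis by (simp add: power_mult_distrib)
  qed
  finally have "h\<^sup>2 > 1 + c\<^sup>2" by (simp add: algebra_simps)
  then show ?thesis using i by (auto simp: y_def h_def c_def)
qed

text \<open>Translating by the inverse of \<open>w\<close>, \<open>- lor x y\<close> becomes the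
  time coordinate of an orbit point other than the base point, to which
  \<open>orbit_point_far\<close> applies.\<close>

lemma orbit_separated:
  "\<exists>e>0. \<forall>w w'. set w \<subseteq> I \<longrightarrow> set w' \<subseteq> I \<longrightarrow> wact r w (1, 0) \<noteq> wact r w' (1, 0) \<longrightarrow>
     dist (wact r w (1, 0)) (wact r w' (1, 0)) \<ge> e"
proof -
  obtain k where k: "k > 0" "\<And>i. i \<in> I \<Longrightarrow> k \<le> (fst (r i))\<^sup>2"
  proof
    define k where "k = Min (insert 1 ((\<lambda>i. (fst (r i))\<^sup>2) ` I))"
    show "k > 0" using finI outward by (auto simp: k_def dest: less_imp_neq[OF outward])
    show "k \<le> (fst (r i))\<^sup>2" if "i \<in> I" for i using that finI by (auto simp: k_def)
  qed
  \<comment> \<open>On the sheet \<open>lor (x - y) (x - y) = 2 * (h - 1)\<close> with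
    \<open>h\<close> at least \<open>sqrt (1 + k)\<close>; the Euclidean square dominates this
    form.\<close>
  define d where "d = 2 * (sqrt (1 + k) - 1)"
  have "sqrt (1 + k) > 1" using k by simp
  then have d: "d > 0" by (simp add: d_def)
  show ?thesis
  proof (rule exI[of _ "sqrt d"], intro conjI allI impI)
    show "sqrt d > 0" using d by simp
    fix w w' assume w: "set w \<subseteq> I" "set w' \<subseteq> I" "wact r w (1, 0) \<noteq> wact r w' (1, 0)"
    define x y where "x = wact r w (1, 0)" and "y = wact r w' (1, 0)"
    have xy: "lor x x = -1" "lor y y = -1" using w by (auto simp: x_def y_def lor_wact)
    define h where "h = fst (wact r (rev w @ w') (1, 0))"
    have h: "h = - lor x y"
      using lor_wact_rev[of w "(1,0)" y] w by (simp add: h_def x_def y_def)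
    have h0: "h > 0" unfolding h_def using w by (intro fst_wact_pos) auto
    have "wact r (rev w @ w') (1, 0) \<noteq> (1, 0)"
    proof
      assume "wact r (rev w @ w') (1, 0) = (1, 0)"
      then have "wact r w (wact r (rev w) (wact r w' (1, 0))) = wact r w (1, 0)" by simp
      then show False using w by simp
    qed
    then have "\<exists>i\<in>I. h\<^sup>2 > 1 + (fst (r i))\<^sup>2"
      unfolding h_def using w by (intro orbit_point_far) auto
    then have "h\<^sup>2 \<ge> 1 + k" using k(2) by fastforce
    then have "h \<ge> sqrt (1 + k)" using h0 by (simp add: real_le_lsqrt)
    then have "d \<le> lor (x - y) (x - y)"
      using xy h by (simp add: d_def lor_commute[of y x])
    also have "\<dots> \<le> (norm (x - y))\<^sup>2" by (simp add: lor_self norm_prod_sq)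
    finally show "dist (wact r w (1, 0)) (wact r w' (1, 0)) \<ge> sqrt d"
      by (simp add: dist_norm x_def y_def real_le_lsqrt)
  qed
qed

lemma finite_orbit_bounded:
  assumes "bounded S"
  shows "finite (S \<inter> {wact r w (1, 0) | w. set w \<subseteq> I})" (is "finite ?T")
proof -
  obtain e where e0: "e > 0" and sep: "\<And>w w'. set w \<subseteq> I \<Longrightarrow> set w' \<subseteq> I \<Longrightarrow>
      wact r w (1, 0) \<noteq> wact r w' (1, 0) \<Longrightarrow> dist (wact r w (1, 0)) (wact r w' (1, 0)) \<ge> e"
    using orbit_separated by meson
  have e: "e > 0" "\<And>x y. x \<in> ?T \<Longrightarrow> y \<in> ?T \<Longrightarrow> dist y x < e \<Longrightarrow> y = x"
  proof -
    fix x y assume "x \<in> ?T" "y \<in> ?T" "dist y x < e"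
    then show "y = x" using sep by (smt (verit) IntE mem_Collect_eq)
  qed (fact e0)
  have "closed ?T" by (rule discrete_imp_closed[OF e(1)]) (use e(2) in blast)
  moreover have "bounded ?T" using assms by (rule bounded_subset) auto
  ultimately have "compact ?T" by (simp add: compact_eq_bounded_closed)
  moreover have "\<not> x islimpt ?T" for x by (rule discrete_imp_not_islimpt[OF e])
  ultimately have "finite (?T \<inter> ?T)" by (intro finite_not_islimpt_in_compact)
  then show ?thesis by simp
qed

section \<open>Convergence along an infinite reduced word\<close>

theorem reduced_orbit_convergent:
  assumes a: "\<And>k. a k \<in> I" and red: "\<And>k. len (map a [0..<k]) = k"
  defines "v \<equiv> \<lambda>k. wact r (map a [0..<k]) (1, 0)"
  shows "filterlim (\<lambda>k. fst (v k)) at_top sequentially"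
    and "\<exists>p. norm p = 1 \<and> (\<lambda>k. snd (v k) /\<^sub>R fst (v k)) \<longlonglongrightarrow> p"
proof -
  define u where "u k = map a [0..<k]" for k
  \<comment> \<open>\<open>g k\<close> is the root of the wall crossed between \<open>v k\<close>
    and \<open>v (Suc k)\<close>; it has positive height \<open>ht k\<close> because the word is
    reduced.\<close>
  define g where "g k = wact r (u k) (r (a k))" for k
  define ht where "ht k = fst (g k)" for k
  define h where "h k = fst (v k)" for k
  have setu: "set (u k) \<subseteq> I" for k using a by (auto simp: u_def)
  have v: "v k = wact r (u k) (1, 0)" for k by (simp add: v_def u_def)
  have u_Suc: "u (Suc k) = u k @ [a k]" for k by (simp add: u_def)
  have vv: "lor (v k) (v k) = -1" for k using setu by (simp add: v lor_wact)
  have h0: "h k > 0" for k using fst_wact_pos[OF setu] by (simp add: h_def v)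
  have gg: "lor (g k) (g k) = 1" for k using setu a by (simp add: g_def lor_wact unit)
  have ht0: "ht k > 0" for k
    unfolding ht_def g_def using red[of k] red[of "Suc k"] setu a
    by (intro ascent_imp_root_pos) (auto simp: u_def)
  have gv: "lor (g k) (v k) = - fst (r (a k))" for k
    using setu by (simp add: g_def v lor_wact)
  \<comment> \<open>The factor \<open>a j # y\<close> of a reduced word is reduced, so root
    positivity puts the image under \<open>y\<close> on the base side of the wall of
    \<open>a j\<close>; reflecting in that wall carries it across.\<close>
  have cross: "lor (g j) (v k) > 0" if jk: "j < k" for j k
  proof -
    define y where "y = map a [Suc j..<k]"
    have y: "set y \<subseteq> I" using a by (auto simp: y_def)
    have uk: "u k = u j @ a j # y"
    proof -
      have "[0..<k] = [0..<j] @ [j..<k]" using jk by (metis le_add_same_cancel1 less_imp_le upt_add_eq_append zero_le le_add_diff_inverse)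
      also have "[j..<k] = j # [Suc j..<k]" using jk by (simp add: upt_conv_Cons)
      finally show ?thesis by (simp add: u_def y_def)
    qed
    have "k \<le> len (u j) + len (a j # y)"
    proof -
      have "len (u k) = k" using red[of k] by (simp add: u_def)
      then show ?thesis
        using len_append_le[of "u j" "a j # y"] setu[of j] y a[of j] unfolding uk by simp
    qed
    then have "len (a j # y) \<ge> Suc (length y)"
      using red[of j] jk by (simp add: u_def y_def)
    moreover have "len (rev y) \<le> length y" using len_le_length[of "rev y"] y by simp
    moreover have "len (rev y @ [a j]) = len (a j # y)" using len_rev[of "a j # y"] a y by simp
    ultimately have "fst (wact r (rev y) (r (a j))) > 0"
      using y a by (intro ascent_imp_root_pos) auto
    then have "lor (wact r (rev y) (r (a j))) (1, 0) < 0" by simp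
    then have neg: "lor (r (a j)) (wact r y (1, 0)) < 0"
      using y lor_wact_rev[of "rev y" "r (a j)" "(1, 0)"] by simp
    have "lor (g j) (v k) = lor (r (a j)) (reflv (r (a j)) (wact r y (1, 0)))"
      using setu by (simp add: g_def v uk lor_wact)
    also have "\<dots> = - lor (r (a j)) (wact r y (1, 0))"
      using unit[OF a[of j]] by (simp add: reflv_def lor_commute[of "wact r y (1, 0)" "r (a j)"])
    finally show ?thesis using neg by simp
  qed
  have inj: "inj g"
  proof (rule linorder_injI)
    fix j k :: nat assume "j < k"
    then have "lor (g j) (v k) > 0" by (rule cross)
    moreover have "lor (g k) (v k) < 0" using gv[of k] outward[OF a] by simp
    ultimately show "g j \<noteq> g k" by auto
  qed
  \<comment> \<open>The sum of two roots has square \<open>2 + 2 * lor (g j) (g k)\<close>. If it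
    were causal it would be negative on the sheet, while both roots are positive once both walls
    have been crossed.\<close>
  have pair: "lor (g j) (g k) > -1" for j k
  proof (rule ccontr)
    assume "\<not> lor (g j) (g k) > -1"
    then have "lor (g j + g k) (g j + g k) \<le> 0"
      using gg by (simp add: lor_commute[of "g k" "g j"])
    moreover have "fst (g j + g k) > 0" using ht0[of j] ht0[of k] by (simp add: ht_def)
    ultimately have "lor (g j + g k) (v (Suc (max j k))) < 0"
      using vv h0 by (intro lor_causal_neg) (auto simp: h_def)
    moreover have "j < Suc (max j k)" "k < Suc (max j k)" by auto
    ultimately show False using cross[of j "Suc (max j k)"] cross[of k "Suc (max j k)"] by simp
  qed

  txt \<open>The reflection in the wall \<open>g k\<close> moves the base point to \<open>(1, 0) + 2 ht k g k\<close>,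
    so discreteness of the orbit forces the heights to infinity.\<close>
  define x where "x k = (1, 0) + (2 * ht k) *\<^sub>R g k" for k
  have x_orbit: "x k \<in> {wact r w (1, 0) | w. set w \<subseteq> I}" for k
  proof -
    define w where "w = u k @ [a k] @ rev (u k)"
    have "wact r w (1, 0) = wact r (u k) (reflv (r (a k)) (wact r (rev (u k)) (1, 0)))"
      by (simp add: w_def)
    also have "\<dots> = (1, 0) - (2 * lor (wact r (rev (u k)) (1, 0)) (r (a k))) *\<^sub>R g k"
      using setu by (simp add: reflv_def wact_diff wact_scale g_def)
    also have "lor (wact r (rev (u k)) (1, 0)) (r (a k)) = - ht k"
      using lor_wact_rev[of "rev (u k)" "(1, 0)" "r (a k)"] setu by (simp add: g_def ht_def)
    finally have "x k = wact r w (1, 0)" by (simp add: x_def)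
    moreover have "set w \<subseteq> I" using setu a by (auto simp: w_def)
    ultimately show ?thesis by blast
  qed
  have x_inj: "inj x"
  proof (rule injI)
    fix j k assume "x j = x k"
    then have e: "ht j *\<^sub>R g j = ht k *\<^sub>R g k" by (simp add: x_def flip: scaleR_scaleR)
    then have "lor (ht j *\<^sub>R g j) (ht j *\<^sub>R g j) = lor (ht k *\<^sub>R g k) (ht k *\<^sub>R g k)" by simp
    then have "ht j = ht k"
      using gg ht0[of j] ht0[of k] by (simp add: power2_eq_iff flip: power2_eq_square)
    then have "g j = g k" using e ht0[of j] by simp
    then show "j = k" using inj by (simp add: inj_eq)
  qed
  \<comment> \<open>The squared norm of \<open>g k\<close> is \<open>1 + 2 * (ht k)^2\<close>, so
    bounded height bounds the distinct orbit points \<open>x k\<close>, of which a ball contains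
    finitely many.\<close>
  have fin: "finite {k. ht k \<le> K}" for K
  proof -
    have "norm (x k) \<le> 1 + 2 * K * (1 + 2 * K)" if "ht k \<le> K" for k
    proof -
      have "(norm (g k))\<^sup>2 = 1 + 2 * (ht k)\<^sup>2" using gg[of k] by (simp add: norm_prod_sq lor_self ht_def)
      also have "\<dots> \<le> (1 + 2 * ht k)\<^sup>2" using ht0[of k] by (simp add: power2_eq_square algebra_simps)
      finally have "norm (g k) \<le> 1 + 2 * ht k" by (rule power2_le_imp_le) (use ht0[of k] in auto)
      then have "2 * ht k * norm (g k) \<le> 2 * K * (1 + 2 * K)"
        using that ht0[of k] by (intro mult_mono) auto
      moreover have "norm (x k) \<le> norm ((1, 0) :: real \<times> complex) + norm ((2 * ht k) *\<^sub>R g k)"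
        unfolding x_def by (rule norm_triangle_ineq)
      ultimately show ?thesis using ht0[of k] by (simp add: norm_Pair)
    qed
    then have "x ` {k. ht k \<le> K} \<subseteq> cball 0 (1 + 2 * K * (1 + 2 * K)) \<inter> {wact r w (1, 0) | w. set w \<subseteq> I}"
      using x_orbit by auto
    then have "finite (x ` {k. ht k \<le> K})"
      using finite_orbit_bounded[OF bounded_cball] finite_subset by blast
    then show ?thesis using x_inj by (metis finite_imageD inj_on_subset top_greatest)
  qed
  have ht_top: "filterlim ht at_top sequentially"
  proof -
    have "eventually (\<lambda>k. ht k > K) sequentially" for K
      using fin[of K] by (simp add: eventually_cofinite not_less flip: cofinite_eq_sequentially)
    then show ?thesis by (simp add: filterlim_at_top_dense)
  qed
  obtain c0 where c0: "c0 > 0" "\<And>i. i \<in> I \<Longrightarrow> c0 \<le> fst (r i)"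
  proof
    show "Min (insert 1 (fst ` r ` I)) > 0" using finI outward by auto
    show "Min (insert 1 (fst ` r ` I)) \<le> fst (r i)" if "i \<in> I" for i using finI that by auto
  qed
  \<comment> \<open>The reflection sends \<open>(1, 0)\<close> to
    \<open>(1, 0) + 2 * fst (r i)\<close> times \<open>r i\<close>; applying \<open>u k\<close>
    turns \<open>r i\<close> into \<open>g k\<close>. Thus \<open>h\<close> inherits divergence from
    \<open>ht\<close>.\<close>
  have h_Suc: "h (Suc k) = h k + 2 * fst (r (a k)) * ht k" for k
    using setu by (simp add: h_def v u_Suc reflv_def wact_add wact_scale wact_diff ht_def g_def)
  have h_top: "filterlim h at_top sequentially"
  proof -
    have "filterlim (\<lambda>k. 2 * c0 * ht k) at_top sequentially"
      using c0 by (intro filterlim_tendsto_pos_mult_at_top[OF tendsto_const _ ht_top]) auto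
    moreover have "2 * c0 * ht k \<le> h (Suc k)" for k
    proof -
      have "2 * c0 * ht k \<le> 2 * fst (r (a k)) * ht k"
        using c0(2)[OF a[of k]] ht0[of k] by (intro mult_right_mono) auto
      then show ?thesis using h_Suc[of k] h0[of k] by linarith
    qed
    ultimately have "filterlim (\<lambda>k. h (Suc k)) at_top sequentially"
      by (auto intro: filterlim_at_top_mono)
    then show ?thesis by (simp add: filterlim_sequentially_Suc)
  qed
  then show "filterlim (\<lambda>k. fst (v k)) at_top sequentially" by (simp add: h_def[abs_def])

  \<comment> \<open>Projective coordinates: \<open>p k\<close> lies outside the unit disk, the orbit
    point \<open>q k\<close> inside, as in the Klein model.\<close>
  define p where "p k = snd (g k) /\<^sub>R ht k" for k
  define q where "q k = snd (v k) /\<^sub>R h k" for k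
  have np: "(norm (p k))\<^sup>2 = 1 + (1 / ht k)\<^sup>2" for k
    using gg[of k] ht0[of k] by (simp add: p_def lor_self ht_def power_mult_distrib field_simps)
  have nq: "(norm (q k))\<^sup>2 = 1 - (1 / h k)\<^sup>2" for k
    using vv[of k] h0[of k] by (simp add: q_def lor_self h_def power_mult_distrib field_simps)
  have diff_sq: "(norm (x - y))\<^sup>2 = (norm x)\<^sup>2 + (norm y)\<^sup>2 - 2 * (x \<bullet> y)" for x y :: complex
    by (simp add: power2_norm_eq_inner inner_diff_left inner_diff_right inner_commute)
  have quot: "x / (s * t) \<ge> 1 - c * (1 / s) * (1 / t)"
    if "x \<ge> s * t - c" "s > 0" "t > 0" for x s t c :: real
  proof -
    have "1 - c * (1 / s) * (1 / t) = (s * t - c) / (s * t)" using that by (simp add: field_simps)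
    also have "\<dots> \<le> x / (s * t)" using that by (intro divide_right_mono) auto
    finally show ?thesis .
  qed
  \<comment> \<open>By \<open>pair\<close> the inner product is at least
    \<open>1 - 1 / (ht j * ht k)\<close>, so the squared distance is at most the square of
    \<open>1 / ht j + 1 / ht k\<close>.\<close>
  have p_close: "norm (p j - p k) \<le> 1 / ht j + 1 / ht k" for j k
  proof -
    have "snd (g j) \<bullet> snd (g k) > ht j * ht k - 1" using pair[of j k] by (simp add: lor_def ht_def)
    then have "p j \<bullet> p k \<ge> 1 - (1 / ht j) * (1 / ht k)"
      using quot[of "ht j" "ht k" 1 "snd (g j) \<bullet> snd (g k)"] ht0[of j] ht0[of k]
      by (simp add: p_def divide_inverse mult_ac)
    then have "(norm (p j - p k))\<^sup>2 \<le> (1 / ht j + 1 / ht k)\<^sup>2"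
      by (simp add: diff_sq np power2_sum)
    then show ?thesis by (rule power2_le_imp_le) (use ht0[of j] ht0[of k] in \<open>auto simp: less_imp_le\<close>)
  qed
  have iht: "(\<lambda>k. 1 / ht k) \<longlonglongrightarrow> 0" and ih: "(\<lambda>k. 1 / h k) \<longlonglongrightarrow> 0"
    using tendsto_inverse_0_at_top[OF ht_top] tendsto_inverse_0_at_top[OF h_top]
    by (simp_all add: inverse_eq_divide)
  have "Cauchy p"
  proof (rule CauchyI)
    fix e :: real assume e: "e > 0"
    then have "eventually (\<lambda>k. 1 / ht k < e / 2) sequentially"
      using order_tendstoD(2)[OF iht, of "e / 2"] by simp
    then obtain M where M: "\<And>k. k \<ge> M \<Longrightarrow> 1 / ht k < e / 2" by (auto simp: eventually_sequentially)
    show "\<exists>M. \<forall>m\<ge>M. \<forall>n\<ge>M. norm (p m - p n) < e"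
    proof (intro exI allI impI)
      fix m n assume "m \<ge> M" "n \<ge> M"
      then show "norm (p m - p n) < e" using p_close[of m n] M[of m] M[of n] by linarith
    qed
  qed
  then obtain l where l: "p \<longlonglongrightarrow> l" by (auto simp: Cauchy_convergent_iff convergent_def)
  obtain c1 where c1: "\<And>i. i \<in> I \<Longrightarrow> fst (r i) \<le> c1"
  proof
    show "fst (r i) \<le> Max (fst ` r ` I)" if "i \<in> I" for i using finI that by auto
  qed
  \<comment> \<open>The product of \<open>g k\<close> and \<open>v k\<close> is bounded by
    \<open>c1\<close> in absolute value: each orbit point stays near the wall it is about to
    cross.\<close>
  have qp: "(norm (q k - p k))\<^sup>2 \<le> (1 / ht k)\<^sup>2 + 2 * c1 * (1 / h k) * (1 / ht k)" for k
  proof -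
    have "snd (g k) \<bullet> snd (v k) = ht k * h k - fst (r (a k))" using gv[of k] by (simp add: lor_def ht_def h_def)
    also have "\<dots> \<ge> ht k * h k - c1" using c1[OF a[of k]] by simp
    finally have "q k \<bullet> p k \<ge> 1 - c1 * (1 / h k) * (1 / ht k)"
      using quot[of "ht k" "h k" c1 "snd (g k) \<bullet> snd (v k)"] ht0[of k] h0[of k]
      by (simp add: p_def q_def inner_commute divide_inverse mult_ac)
    then have "(norm (q k - p k))\<^sup>2 \<le> (1 / ht k)\<^sup>2 - (1 / h k)\<^sup>2 + 2 * c1 * (1 / h k) * (1 / ht k)"
      unfolding diff_sq np nq by linarith
    then show ?thesis by (smt (verit) zero_le_power2)
  qed
  have "(\<lambda>k. (1 / ht k)\<^sup>2 + 2 * c1 * (1 / h k) * (1 / ht k)) \<longlonglongrightarrow> 0\<^sup>2 + 2 * c1 * 0 * 0"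
    by (intro tendsto_intros iht ih)
  then have lim: "(\<lambda>k. (1 / ht k)\<^sup>2 + 2 * c1 * (1 / h k) * (1 / ht k)) \<longlonglongrightarrow> 0"
    by simp
  have "(\<lambda>k. (norm (q k - p k))\<^sup>2) \<longlonglongrightarrow> 0"
    by (rule tendsto_sandwich[OF _ _ tendsto_const lim])
      (use qp in \<open>auto intro!: always_eventually simp del: divide_inverse\<close>)
  then have "(\<lambda>k. norm (q k - p k)) \<longlonglongrightarrow> 0"
    using tendsto_real_sqrt[of "\<lambda>k. (norm (q k - p k))\<^sup>2" 0] by simp
  then have "(\<lambda>k. (q k - p k) + p k) \<longlonglongrightarrow> 0 + l"
    by (intro tendsto_add l) (simp add: tendsto_norm_zero_iff)
  then have ql: "q \<longlonglongrightarrow> l" by simp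
  have "(\<lambda>k. (norm (q k))\<^sup>2) \<longlonglongrightarrow> (norm l)\<^sup>2" by (intro tendsto_intros ql)
  moreover have "(\<lambda>k. 1 - (1 / h k)\<^sup>2) \<longlonglongrightarrow> 1 - 0\<^sup>2" by (intro tendsto_intros ih)
  ultimately have "(norm l)\<^sup>2 = 1" by (simp add: nq LIMSEQ_unique)
  then have "norm l = 1" using power2_eq_1_iff[of "norm l"] norm_ge_zero[of l] by linarith
  then show "\<exists>p. norm p = 1 \<and> (\<lambda>k. snd (v k) /\<^sub>R fst (v k)) \<longlonglongrightarrow> p"
    using ql by (auto simp: q_def[abs_def] h_def)
qed

end

section \<open>Every element has an ascent among the three generators\<close>

lemma three_planar_dependent:
  fixes a b c :: complex
  assumes "a \<noteq> 0"
  shows "\<exists>x y z :: real. (x, y, z) \<noteq> (0, 0, 0) \<and> x *\<^sub>R a + y *\<^sub>R b + z *\<^sub>R c = 0"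
proof (cases "Im (cnj b * c) = 0 \<and> Im (cnj c * a) = 0 \<and> Im (cnj a * b) = 0")
  case False
  \<comment> \<open>\<open>Im (cnj b * c)\<close> is the determinant of \<open>b\<close> and
    \<open>c\<close>; these three determinants always give a linear relation. If all vanish,
    \<open>a\<close> and \<open>b\<close> are already parallel.\<close>
  show ?thesis
    by (rule exI[of _ "Im (cnj b * c)"], rule exI[of _ "Im (cnj c * a)"], rule exI[of _ "Im (cnj a * b)"])
      (use False in \<open>auto simp: complex_eq_iff algebra_simps\<close>)
next
  case True
  show ?thesis
  proof (cases "Re a = 0")
    case False
    then show ?thesis
      by (intro exI[of _ "Re b"] exI[of _ "- Re a"] exI[of _ 0]) (use True in \<open>auto simp: complex_eq_iff algebra_simps\<close>)
  next
    case Ra: True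
    then have "Im a \<noteq> 0" using assms by (auto simp: complex_eq_iff)
    then show ?thesis
      by (intro exI[of _ "Im b"] exI[of _ "- Im a"] exI[of _ 0]) (use True Ra in \<open>auto simp: complex_eq_iff algebra_simps\<close>)
  qed
qed

text \<open>Replacing the coefficients \<open>c\<close> of a vector with vanishing space part by \<open>\<bar>c\<bar>\<close> does not
  increase the quadratic form, because the mixed products are nonpositive.\<close>
lemma causal_nonneg_combination:
  assumes U: "lor a a = 1" "lor b b = 1" "lor c c = 1"
    and G: "lor a b \<le> 0" "lor a c \<le> 0" "lor b c \<le> 0"
  shows "\<exists>x y z. x \<ge> 0 \<and> y \<ge> 0 \<and> z \<ge> 0 \<and> (x, y, z) \<noteq> (0, 0, 0) \<and>
    lor (x *\<^sub>R a + y *\<^sub>R b + z *\<^sub>R c) (x *\<^sub>R a + y *\<^sub>R b + z *\<^sub>R c) \<le> 0"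
proof -
  have "snd a \<noteq> 0" using U(1) by (auto simp: lor_self) (smt (verit) zero_le_power2)
  then obtain x y z :: real where nz: "(x, y, z) \<noteq> (0, 0, 0)"
    and dep: "x *\<^sub>R snd a + y *\<^sub>R snd b + z *\<^sub>R snd c = 0"
    using three_planar_dependent by blast
  have quad: "lor (x *\<^sub>R a + y *\<^sub>R b + z *\<^sub>R c) (x *\<^sub>R a + y *\<^sub>R b + z *\<^sub>R c)
    = x\<^sup>2 + y\<^sup>2 + z\<^sup>2 + 2 * (x * y * lor a b) + 2 * (x * z * lor a c) + 2 * (y * z * lor b c)" for x y z
    by (simp add: U lor_commute[of b a] lor_commute[of c a] lor_commute[of c b] algebra_simps power2_eq_square)
  have abs_le: "\<bar>x\<bar> * \<bar>y\<bar> * g \<le> x * y * g" if "g \<le> 0" for x y g :: real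
    using mult_right_mono_neg[OF abs_ge_self[of "x * y"] that] by (simp add: abs_mult)
  have "lor (x *\<^sub>R a + y *\<^sub>R b + z *\<^sub>R c) (x *\<^sub>R a + y *\<^sub>R b + z *\<^sub>R c) \<le> 0"
    using dep by (simp add: lor_self)
  then have "lor (\<bar>x\<bar> *\<^sub>R a + \<bar>y\<bar> *\<^sub>R b + \<bar>z\<bar> *\<^sub>R c) (\<bar>x\<bar> *\<^sub>R a + \<bar>y\<bar> *\<^sub>R b + \<bar>z\<bar> *\<^sub>R c) \<le> 0"
    unfolding quad using abs_le[OF G(1), of x y] abs_le[OF G(2), of x z] abs_le[OF G(3), of y z]
    unfolding power2_abs by linarith
  moreover have "(\<bar>x\<bar>, \<bar>y\<bar>, \<bar>z\<bar>) \<noteq> (0, 0, 0)" using nz by simp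
  ultimately show ?thesis using abs_ge_zero by blast
qed

text \<open>If all three were descents, the inverse of \<open>w\<close> would send the base point to
  a \<open>y\<close> with positive product with every root. A nonnegative combination of the roots
  is future causal, hence negative at \<open>y\<close>.\<close>

lemma (in chamber) not_all_descents:
  assumes I: "I = {1, 2, 3}" and w: "set w \<subseteq> I"
  shows "\<exists>i\<in>I. len (w @ [i]) > len w"
proof (rule ccontr)
  assume "\<not> ?thesis"
  then have neg: "fst (wact r w (r i)) < 0" if "i \<in> I" for i
    using descent_imp_root_neg w that by auto
  define y where "y = wact r (rev w) (1, 0)"
  have y: "lor y y = -1" "fst y > 0" using w fst_wact_pos[of "rev w"] by (auto simp: y_def lor_wact)
  have pos: "lor (r i) y > 0" if "i \<in> I" for i
    using neg[OF that] lor_wact_rev[OF w, of "r i" "(1, 0)"] by (simp add: y_def)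
  \<comment> \<open>For \<open>m\<close> at least 2 the angle \<open>pi / m\<close> is at most
    \<open>pi / 2\<close>, so both cases of \<open>gram\<close> give nonpositive products, as
    \<open>causal_nonneg_combination\<close> requires.\<close>
  have G: "lor (r i) (r j) \<le> 0" if "i \<in> I" "j \<in> I" "i \<noteq> j" for i j
  proof -
    have "cos (pi / real m) \<ge> 0" if "m \<ge> 2" for m :: nat
    proof (rule cos_ge_zero)
      show "pi / real m \<le> pi / 2" using that by (intro divide_left_mono) auto
      have "pi / real m \<ge> 0" by simp
      then show "- (pi / 2) \<le> pi / real m" using pi_gt_zero by linarith
    qed
    then show ?thesis using gram[OF that] by fastforce
  qed
  obtain c1 c2 c3 where c: "c1 \<ge> 0" "c2 \<ge> 0" "c3 \<ge> 0" "(c1, c2, c3) \<noteq> (0, 0, 0)"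
    and le: "lor (c1 *\<^sub>R r 1 + c2 *\<^sub>R r 2 + c3 *\<^sub>R r 3) (c1 *\<^sub>R r 1 + c2 *\<^sub>R r 2 + c3 *\<^sub>R r 3) \<le> 0"
    using causal_nonneg_combination[of "r 1" "r 2" "r 3"] unit G unfolding I by auto
  have combine: "c1 * t1 + c2 * t2 + c3 * t3 > 0" if "t1 > 0" "t2 > 0" "t3 > 0" for t1 t2 t3 :: real
  proof -
    have "c1 * t1 \<ge> 0" "c2 * t2 \<ge> 0" "c3 * t3 \<ge> 0" using c that by auto
    moreover have "c1 * t1 \<noteq> 0 \<or> c2 * t2 \<noteq> 0 \<or> c3 * t3 \<noteq> 0" using c that by auto
    ultimately show ?thesis by linarith
  qed
  have "fst (c1 *\<^sub>R r 1 + c2 *\<^sub>R r 2 + c3 *\<^sub>R r 3) > 0"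
    using combine[of "fst (r 1)" "fst (r 2)" "fst (r 3)"] outward I by simp
  from lor_causal_neg[OF le this y] show False
    using combine[of "lor (r 1) y" "lor (r 2) y" "lor (r 3) y"] pos I by simp
qed

section \<open>The hyperboloid model of the upper half-plane\<close>

text \<open>The hyperboloid model, normalised so that \<open>z0\<close> becomes \<open>(1, 0)\<close>: the first component is the
  hyperbolic cosine of the distance to \<open>z0\<close>.\<close>
definition emb :: "complex \<Rightarrow> complex \<Rightarrow> real \<times> complex" where
  "emb z0 z = (((Re z - Re z0)\<^sup>2 + (Im z)\<^sup>2 + (Im z0)\<^sup>2) / (2 * Im z * Im z0),
     Complex ((Re z - Re z0) / Im z) (((Re z - Re z0)\<^sup>2 + (Im z)\<^sup>2 - (Im z0)\<^sup>2) / (2 * Im z * Im z0)))"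

text \<open>The Lorentz unit normal of the geodesic, scaled so that its product with
  \<open>emb z0 z\<close> is \<open>lfun l z / Im z\<close>.\<close>

fun lvec :: "complex \<Rightarrow> hline \<Rightarrow> real \<times> complex" where
  "lvec z0 (Vert x) = ((x - Re z0) / Im z0, Complex 1 ((x - Re z0) / Im z0))"
| "lvec z0 (Circ x r) =
    (- (Im z0 + ((x - Re z0)\<^sup>2 - r\<^sup>2) / Im z0) / (2 * r),
     Complex (- (x - Re z0) / r) ((Im z0 - ((x - Re z0)\<^sup>2 - r\<^sup>2) / Im z0) / (2 * r)))"

text \<open>A signed equation of the line; the factor \<open>1 / (2 * r)\<close> makes its gradient
  on the line the unit vector \<open>lnormal\<close>.\<close>

fun lfun :: "hline \<Rightarrow> complex \<Rightarrow> real" where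
  "lfun (Vert x) z = Re z - x"
| "lfun (Circ x r) z = ((cmod (z - complex_of_real x))\<^sup>2 - r\<^sup>2) / (2 * r)"

fun lnormal :: "hline \<Rightarrow> complex \<Rightarrow> complex" where
  "lnormal (Vert x) p = 1"
| "lnormal (Circ x r) p = (p - complex_of_real x) / complex_of_real r"

section \<open>Lines and reflections on the hyperboloid\<close>

lemma lor_Complex: "lor (t, Complex a b) (t', Complex a' b') = a * a' + b * b' - t * t'"
  by (simp add: lor_def inner_complex_def)

lemma cmod_sq_shift: "(cmod (z - complex_of_real x))\<^sup>2 = (Re z - x)\<^sup>2 + (Im z)\<^sup>2"
  by (simp add: cmod_power2)

lemma emb_base: "z0 \<in> upper \<Longrightarrow> emb z0 z0 = (1, 0)"
  by (simp add: emb_def upper_def Complex_eq power2_eq_square)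

text \<open>Up to the constants \<open>x\<close> and \<open>z0\<close>, the embedding is linear in the three functions
  \<open>Re (z - x) / Im z\<close>, \<open>1 / Im z\<close> and \<open>\<bar>z - x\<bar>\<^sup>2 / Im z\<close>, on which reflections act very simply.\<close>
definition embl :: "complex \<Rightarrow> real \<Rightarrow> real \<Rightarrow> real \<Rightarrow> real \<Rightarrow> real \<times> complex" where
  "embl z0 x A R P =
    (let d = x - Re z0; S = (P + 2 * d * A + d\<^sup>2 * R) / (2 * Im z0); T = Im z0 * R / 2
     in (S + T, Complex (A + d * R) (S - T)))"

lemma emb_eq_embl:
  assumes "z0 \<in> upper" "z \<in> upper"
  shows "emb z0 z = embl z0 x ((Re z - x) / Im z) (1 / Im z) (((Re z - x)\<^sup>2 + (Im z)\<^sup>2) / Im z)"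
  using assms by (simp add: emb_def embl_def upper_def Let_def field_simps power2_eq_square)

lemma embl_diff: "embl z0 x A R P - embl z0 x A' R' P' = embl z0 x (A - A') (R - R') (P - P')"
  by (simp add: embl_def Let_def complex_eq_iff algebra_simps diff_divide_distrib add_divide_distrib)

lemma embl_scale: "embl z0 x (c * A) (c * R) (c * P) = c *\<^sub>R embl z0 x A R P"
  by (simp add: embl_def Let_def complex_eq_iff algebra_simps diff_divide_distrib add_divide_distrib)

lemma lvec_Vert_embl: "lvec z0 (Vert x) = embl z0 x 1 0 0"
  by (simp add: embl_def Let_def)

lemma lvec_Circ_embl: "z0 \<in> upper \<Longrightarrow> r > 0 \<Longrightarrow> lvec z0 (Circ x r) = embl z0 x 0 (- 1 / r) r"
  by (simp add: embl_def Let_def upper_def field_simps power2_eq_square)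

text \<open>The form looks the same for every \<open>x\<close> and \<open>z0\<close>, so products
  can be computed around the most convenient centre.\<close>

lemma lor_embl:
  assumes "z0 \<in> upper"
  shows "lor (embl z0 x A R P) (embl z0 x A' R' P') = A * A' - (R * P' + P * R') / 2"
proof -
  define d y where "d = x - Re z0" and "y = Im z0"
  define S S' where "S = (P + 2 * d * A + d\<^sup>2 * R) / (2 * y)" and "S' = (P' + 2 * d * A' + d\<^sup>2 * R') / (2 * y)"
  have y: "y \<noteq> 0" using assms by (simp add: upper_def y_def)
  have S: "2 * y * S = P + 2 * d * A + d\<^sup>2 * R" "2 * y * S' = P' + 2 * d * A' + d\<^sup>2 * R'"
    using y by (simp_all add: S_def S'_def)
  have "lor (embl z0 x A R P) (embl z0 x A' R' P')
      = (A + d * R) * (A' + d * R') + (S - y * R / 2) * (S' - y * R' / 2) - (S + y * R / 2) * (S' + y * R' / 2)"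
    by (simp add: embl_def Let_def lor_Complex d_def y_def S_def S'_def)
  also have "\<dots> = (A + d * R) * (A' + d * R') - (R' * (2 * y * S) + R * (2 * y * S')) / 2"
    by (simp add: algebra_simps)
  also have "\<dots> = A * A' - (R * P' + P * R') / 2"
    unfolding S by (simp add: field_simps power2_eq_square)
  finally show ?thesis .
qed

lemma lor_emb_self:
  assumes "z0 \<in> upper" "z \<in> upper"
  shows "lor (emb z0 z) (emb z0 z) = -1"
  using assms by (simp add: emb_eq_embl[of z0 z 0] lor_embl upper_def field_simps power2_eq_square)

lemma fst_emb_pos: "z0 \<in> upper \<Longrightarrow> z \<in> upper \<Longrightarrow> fst (emb z0 z) > 0"
  by (auto simp: emb_def upper_def intro!: divide_pos_pos add_nonneg_pos)

lemma lor_emb_lvec: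
  assumes "z0 \<in> upper" "z \<in> upper" "valid_line l"
  shows "lor (emb z0 z) (lvec z0 l) = lfun l z / Im z"
proof (cases l)
  case (Vert x)
  then show ?thesis using assms by (simp only: lvec_Vert_embl emb_eq_embl[of z0 z x] lor_embl) simp
next
  case (Circ x r)
  then have r: "r > 0" using assms by simp
  have "lor (emb z0 z) (lvec z0 l) =
      - (1 / Im z * r + ((Re z - x)\<^sup>2 + (Im z)\<^sup>2) / Im z * (- 1 / r)) / 2"
    using assms r Circ by (simp only: lvec_Circ_embl emb_eq_embl[of z0 z x] lor_embl mult_zero_right diff_0 minus_divide_left)
  also have "\<dots> = lfun l z / Im z"
  proof -
    have "lfun l z = ((Re z - x)\<^sup>2 + (Im z)\<^sup>2 - r\<^sup>2) / (2 * r)"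
      using Circ by (simp only: lfun.simps cmod_sq_shift)
    moreover have "- (1 / y * r + N / y * (- 1 / r)) / 2 = (N - r\<^sup>2) / (2 * r) / y" if "y > 0" for y N :: real
      using r that by (simp add: field_simps power2_eq_square)
    ultimately show ?thesis using assms(2) by (simp only: upper_def mem_Collect_eq)
  qed
  finally show ?thesis .
qed

lemma lor_lvec_self:
  assumes "z0 \<in> upper" "valid_line l"
  shows "lor (lvec z0 l) (lvec z0 l) = 1"
proof (cases l)
  case (Vert x)
  then show ?thesis using assms by (simp only: lvec_Vert_embl lor_embl) simp
next
  case (Circ x r)
  then show ?thesis using assms by (simp only: lvec_Circ_embl lor_embl valid_line.simps) simp
qed

text \<open>Recentring at \<open>y\<close> puts two lines with different centres into common
  coordinates.\<close>

lemma lvec_Circ_embl_shift: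
  assumes "z0 \<in> upper" "r > 0"
  shows "lvec z0 (Circ x r) = embl z0 y (- (x - y) / r) (- 1 / r) (r - (x - y)\<^sup>2 / r)"
  using assms by (simp add: embl_def Let_def upper_def field_simps power2_eq_square)

lemma lor_lvec:
  assumes "z0 \<in> upper"
  shows "lor (lvec z0 (Vert x)) (lvec z0 (Vert x')) = 1"
    and "r > 0 \<Longrightarrow> lor (lvec z0 (Vert x)) (lvec z0 (Circ x' r)) = (x - x') / r"
    and "r > 0 \<Longrightarrow> r' > 0 \<Longrightarrow>
      lor (lvec z0 (Circ x r)) (lvec z0 (Circ x' r')) = (r\<^sup>2 + r'\<^sup>2 - (x - x')\<^sup>2) / (2 * r * r')"
proof -
  show "lor (lvec z0 (Vert x)) (lvec z0 (Vert x')) = 1"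
    by (simp add: lor_Complex)
  assume r: "r > 0"
  show "lor (lvec z0 (Vert x)) (lvec z0 (Circ x' r)) = (x - x') / r"
    using assms r by (simp only: lvec_Vert_embl lvec_Circ_embl_shift[of z0 r x' x] lor_embl)
      simp
  assume r': "r' > 0"
  show "lor (lvec z0 (Circ x r)) (lvec z0 (Circ x' r')) = (r\<^sup>2 + r'\<^sup>2 - (x - x')\<^sup>2) / (2 * r * r')"
    using assms r r' by (simp only: lvec_Circ_embl[of z0 r x] lvec_Circ_embl_shift[of z0 r' x' x] lor_embl)
      (simp add: field_simps power2_eq_square)
qed

lemma refl_Circ_coords:
  fixes x :: real
  assumes "z \<in> upper" "r > 0"
  defines "N \<equiv> (Re z - x)\<^sup>2 + (Im z)\<^sup>2"
  shows "Re (refl (Circ x r) z) - x = r\<^sup>2 * (Re z - x) / N" "Im (refl (Circ x r) z) = r\<^sup>2 * Im z / N"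
    "N > 0"
proof -
  show N: "N > 0" using assms by (simp add: upper_def N_def add_nonneg_pos)
  have "refl (Circ x r) z = complex_of_real x + complex_of_real (r\<^sup>2 / N) * (z - complex_of_real x)"
  proof -
    have "(z - complex_of_real x) * cnj (z - complex_of_real x) = complex_of_real N"
      unfolding complex_mult_cnj by (simp add: N_def)
    moreover have "cnj z - complex_of_real x \<noteq> 0" using assms by (auto simp: upper_def complex_eq_iff)
    ultimately have "1 / (cnj z - complex_of_real x) = (z - complex_of_real x) / complex_of_real N"
      using N by (simp add: divide_simps)
    moreover have "refl (Circ x r) z = complex_of_real (r\<^sup>2) * (1 / (cnj z - complex_of_real x)) + complex_of_real x"
      by simp
    ultimately show ?thesis by (simp only:) (simp add: mult_ac)
  qed
  then show "Re (refl (Circ x r) z) - x = r\<^sup>2 * (Re z - x) / N" "Im (refl (Circ x r) z) = r\<^sup>2 * Im z / N"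
    by simp_all
qed

lemma refl_upper:
  assumes "z \<in> upper" "valid_line l"
  shows "refl l z \<in> upper"
proof (cases l)
  case (Vert x)
  then show ?thesis using assms by (simp add: upper_def)
next
  case (Circ x r)
  then show ?thesis using refl_Circ_coords[of z r x] assms by (simp add: upper_def del: refl.simps)
qed

text \<open>In coordinates centred on the line, a vertical reflection negates the first coordinate,
  while inversion keeps it and exchanges the other two up to the factor \<open>r^2\<close>. Either
  way the change is a multiple of \<open>lvec\<close>.\<close>

lemma emb_refl:
  assumes "z0 \<in> upper" "z \<in> upper" "valid_line l"
  shows "emb z0 (refl l z) = reflv (lvec z0 l) (emb z0 z)"
proof (cases l)
  case (Vert x)
  have "emb z0 (refl l z) - emb z0 z = embl z0 x (- (2 * (lfun l z / Im z)) * 1) (- (2 * (lfun l z / Im z)) * 0) (- (2 * (lfun l z / Im z)) * 0)"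
    using assms refl_upper[OF assms(2,3)] Vert
    by (simp add: emb_eq_embl[of z0 _ x] embl_diff diff_divide_distrib power2_eq_square algebra_simps)
  then show ?thesis
    unfolding embl_scale using assms Vert
    by (simp add: reflv_def lor_emb_lvec lvec_Vert_embl[symmetric] algebra_simps del: lvec.simps lfun.simps refl.simps)
next
  case (Circ x r)
  then have r: "r > 0" using assms by simp
  define a b N where "a = Re z - x" and "b = Im z" and "N = a\<^sup>2 + b\<^sup>2"
  have b: "b > 0" using assms by (simp add: b_def upper_def)
  have co: "Re (refl l z) - x = r\<^sup>2 * a / N" "Im (refl l z) = r\<^sup>2 * b / N" "N > 0"
    using refl_Circ_coords[of z r x] assms(2) r Circ by (simp_all add: a_def b_def N_def del: refl.simps)
  define f where "f = lfun l z / Im z"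
  have f: "f = (N / b - r\<^sup>2 / b) / (2 * r)"
    using Circ r b by (simp add: f_def cmod_sq_shift a_def b_def N_def field_simps)
  have sq: "(r\<^sup>2 * a / N)\<^sup>2 + (r\<^sup>2 * b / N)\<^sup>2 = r^4 / N"
  proof -
    have "(r\<^sup>2 * a / N)\<^sup>2 + (r\<^sup>2 * b / N)\<^sup>2 = r^4 * (a\<^sup>2 + b\<^sup>2) / N\<^sup>2"
      by (simp add: power_divide power_mult_distrib add_divide_distrib algebra_simps flip: power_mult)
    then show ?thesis using co(3) by (simp add: N_def power2_eq_square)
  qed
  have e1: "emb z0 (refl l z) = embl z0 x (a / b) (N / b / r\<^sup>2) (r\<^sup>2 / b)"
    using co b r unfolding emb_eq_embl[OF assms(1) refl_upper[OF assms(2,3)], of x] co(1,2) sq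
    by (simp add: field_simps power2_eq_square power4_eq_xxxx)
  have e2: "emb z0 z = embl z0 x (a / b) (1 / b) (N / b)"
    using emb_eq_embl[OF assms(1,2), of x] by (simp add: a_def b_def N_def)
  have "emb z0 (refl l z) - emb z0 z = embl z0 x ((- 2 * f) * 0) ((- 2 * f) * (- 1 / r)) ((- 2 * f) * r)"
  proof -
    have "N / b / r\<^sup>2 - 1 / b = (- 2 * f) * (- 1 / r)" "r\<^sup>2 / b - N / b = (- 2 * f) * r"
      unfolding f using r b by (simp_all add: divide_simps power2_eq_square)
    then show ?thesis unfolding e1 e2 embl_diff by simp
  qed
  then have "emb z0 (refl l z) - emb z0 z = (- 2 * f) *\<^sub>R lvec z0 l"
    unfolding embl_scale using assms Circ r by (simp add: lvec_Circ_embl del: lvec.simps)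
  then show ?thesis
    using assms by (simp add: reflv_def lor_emb_lvec f_def algebra_simps)
qed

section \<open>Position of two lines and the product of their normals\<close>

lemma line_set_eq:
  assumes "valid_line l"
  shows "line_set l = {z \<in> upper. lfun l z = 0}"
proof (cases l)
  case (Circ x r)
  have "cmod w = r \<longleftrightarrow> (cmod w)\<^sup>2 = r\<^sup>2" for w
    using assms Circ by (simp add: power2_eq_iff_nonneg)
  then show ?thesis using assms Circ by auto
qed auto

lemma line_set_nonempty:
  assumes "valid_line l"
  shows "line_set l \<noteq> {}"
proof (cases l)
  case (Vert x)
  then have "Complex x 1 \<in> line_set l" by (simp add: upper_def)
  then show ?thesis by blast
next
  case (Circ x r)
  then have "Complex x r \<in> line_set l" using assms by (simp add: upper_def cmod_def)
  then show ?thesis by blast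
qed

text \<open>A product below 1 in absolute value is the condition on centres and radii under which an
  explicit common point has positive height.\<close>

lemma lines_intersect:
  assumes "z0 \<in> upper" "valid_line l" "valid_line l'" "\<bar>lor (lvec z0 l) (lvec z0 l')\<bar> < 1"
  shows "line_set l \<inter> line_set l' \<noteq> {}"
proof -
  have VC: "line_set (Vert x) \<inter> line_set (Circ x' r) \<noteq> {}" if "r > 0" "\<bar>(x - x') / r\<bar> < 1" for x x' r
  proof -
    have "\<bar>x - x'\<bar> < r" using that by (simp add: field_simps)
    then have lt: "(x - x')\<^sup>2 < r\<^sup>2" using power_strict_mono[of "\<bar>x - x'\<bar>" r 2] by simp
    define z where "z = Complex x (sqrt (r\<^sup>2 - (x - x')\<^sup>2))"
    have "z \<in> upper" using lt by (simp add: z_def upper_def)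
    moreover have "lfun (Circ x' r) z = 0" using lt by (simp add: z_def cmod_sq_shift)
    ultimately show ?thesis
      using line_set_eq[of "Circ x' r"] that by (auto simp: z_def simp del: line_set.simps(2))
  qed
  have CC: "line_set (Circ x r) \<inter> line_set (Circ x' r') \<noteq> {}"
    if r: "r > 0" "r' > 0" "\<bar>(r\<^sup>2 + r'\<^sup>2 - (x - x')\<^sup>2) / (2 * r * r')\<bar> < 1" for x r x' r'
  proof -
    define D where "D = x' - x"
    have abs: "\<bar>r\<^sup>2 + r'\<^sup>2 - D\<^sup>2\<bar> < 2 * r * r'"
      using r by (simp add: D_def field_simps power2_commute)
    have D: "D \<noteq> 0"
    proof
      assume "D = 0"
      then have "r\<^sup>2 + r'\<^sup>2 < 2 * r * r'" using abs by simp
      then show False using sum_squares_bound[of r r'] by simp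
    qed
    \<comment> \<open>\<open>x + a\<close> is where the radical axis of the two circles meets the
      real axis; the Heron-type identity below turns \<open>abs\<close> into positivity of
      \<open>r^2 - a^2\<close>.\<close>
    define a where "a = (D\<^sup>2 + r\<^sup>2 - r'\<^sup>2) / (2 * D)"
    have a: "2 * D * a = D\<^sup>2 + r\<^sup>2 - r'\<^sup>2" using D by (simp add: a_def)
    have "(r\<^sup>2 + r'\<^sup>2 - D\<^sup>2)\<^sup>2 < (2 * r * r')\<^sup>2"
      using power_strict_mono[OF abs, of 2] by simp
    moreover have "4 * D\<^sup>2 * (r\<^sup>2 - a\<^sup>2) = (2 * r * r')\<^sup>2 - (r\<^sup>2 + r'\<^sup>2 - D\<^sup>2)\<^sup>2"
    proof -
      have "4 * D\<^sup>2 * (r\<^sup>2 - a\<^sup>2) = 4 * D\<^sup>2 * r\<^sup>2 - (2 * D * a)\<^sup>2"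
        by (simp add: algebra_simps power2_eq_square)
      then show ?thesis unfolding a by (simp add: algebra_simps power2_eq_square)
    qed
    ultimately have "4 * D\<^sup>2 * (r\<^sup>2 - a\<^sup>2) > 0" by simp
    then have pos: "r\<^sup>2 - a\<^sup>2 > 0" using D by (simp add: zero_less_mult_iff)
    define z where "z = Complex (x + a) (sqrt (r\<^sup>2 - a\<^sup>2))"
    have "z \<in> upper" using pos by (simp add: z_def upper_def)
    moreover have "lfun (Circ x r) z = 0" using pos by (simp add: z_def cmod_sq_shift)
    moreover have "(x + a - x')\<^sup>2 + (r\<^sup>2 - a\<^sup>2) = r'\<^sup>2"
    proof -
      have "(x + a - x')\<^sup>2 + (r\<^sup>2 - a\<^sup>2) = D\<^sup>2 - 2 * D * a + r\<^sup>2"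
        by (simp add: D_def algebra_simps power2_eq_square)
      then show ?thesis using a by simp
    qed
    then have "lfun (Circ x' r') z = 0" using pos by (simp add: z_def cmod_sq_shift)
    ultimately show ?thesis
      using line_set_eq[of "Circ x r"] line_set_eq[of "Circ x' r'"] r by (auto simp del: line_set.simps lfun.simps)
  qed
  show ?thesis
  proof (cases l; cases l')
    fix x x' assume "l = Vert x" "l' = Vert x'"
    then show ?thesis using assms by (simp add: lor_lvec del: lvec.simps)
  next
    fix x x' r assume "l = Vert x" "l' = Circ x' r"
    then show ?thesis using assms VC[of r x x'] by (simp add: lor_lvec del: lvec.simps line_set.simps)
  next
    fix x x' r assume "l = Circ x' r" "l' = Vert x"
    then show ?thesis using assms VC[of r x x']
      by (simp add: lor_lvec lor_commute[of "lvec z0 (Circ x' r)"] Int_commute del: lvec.simps line_set.simps)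
  next
    fix x r x' r' assume "l = Circ x r" "l' = Circ x' r'"
    then show ?thesis using assms CC[of r r' x x'] by (simp add: lor_lvec del: lvec.simps line_set.simps)
  qed
qed

lemma continuous_lfun: "continuous_on S (lfun l)"
proof (cases l)
  case (Vert x)
  then have "lfun l = (\<lambda>z. Re z - x)" by auto
  then show ?thesis by (auto intro!: continuous_intros)
next
  case (Circ x r)
  then have "lfun l = (\<lambda>z. ((cmod (z - complex_of_real x))\<^sup>2 - r\<^sup>2) * (1 / (2 * r)))" by auto
  then show ?thesis by (simp only:) (intro continuous_intros)
qed

lemma connected_same_sign:
  fixes f :: "'a::topological_space \<Rightarrow> real"
  assumes "connected C" "continuous_on C f" "\<And>z. z \<in> C \<Longrightarrow> f z \<noteq> 0" "a \<in> C" "b \<in> C"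
  shows "sgn (f a) = sgn (f b)"
proof (rule ccontr)
  assume ne: "sgn (f a) \<noteq> sgn (f b)"
  have conn: "connected (f ` C)" using assms by (intro connected_continuous_image)
  have "f a \<noteq> 0" "f b \<noteq> 0" using assms by auto
  with ne have "f a < 0 \<and> 0 < f b \<or> f b < 0 \<and> 0 < f a" by (auto simp: sgn_if split: if_splits)
  then have "0 \<in> f ` C"
    using connectedD_interval[OF conn, of "f a" "f b" 0] connectedD_interval[OF conn, of "f b" "f a" 0] assms(4,5)
    by auto
  then show False using assms(3) by auto
qed

lemma component_same_sign:
  assumes "valid_line l" "line_set l \<subseteq> M" "connected C" "C \<subseteq> upper - M" "z0 \<in> C" "z \<in> C"
  shows "sgn (lfun l z0) * lfun l z > 0"
proof -
  have nz: "lfun l w \<noteq> 0" if "w \<in> C" for w using that assms line_set_eq[of l] by auto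
  have "sgn (lfun l z0) = sgn (lfun l z)"
    using assms nz by (intro connected_same_sign[of C] continuous_lfun) auto
  then show ?thesis using nz[OF assms(6)] by (simp add: sgn_if split: if_splits)
qed

text \<open>The sign makes the product with \<open>emb z0 z0\<close> negative whenever
  \<open>z0\<close> is off the line.\<close>

definition outer :: "complex \<Rightarrow> hline \<Rightarrow> real \<times> complex" where
  "outer z0 l = (- sgn (lfun l z0)) *\<^sub>R lvec z0 l"

lemma lor_outer_emb:
  assumes "z0 \<in> upper" "z \<in> upper" "valid_line l"
  shows "lor (outer z0 l) (emb z0 z) = - sgn (lfun l z0) * lfun l z / Im z"
  using assms by (simp add: outer_def lor_commute[of "lvec z0 l"] lor_emb_lvec)

lemma lor_outer_self:
  assumes "z0 \<in> upper" "valid_line l" "lfun l z0 \<noteq> 0"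
  shows "lor (outer z0 l) (outer z0 l) = 1"
  using assms by (simp add: outer_def lor_lvec_self sgn_if)

lemma fst_outer_pos:
  assumes "z0 \<in> upper" "valid_line l" "lfun l z0 \<noteq> 0"
  shows "fst (outer z0 l) > 0"
proof -
  have "lor (outer z0 l) (emb z0 z0) = - \<bar>lfun l z0\<bar> / Im z0"
    using assms by (simp add: lor_outer_emb abs_sgn mult.commute)
  then have "fst (outer z0 l) = \<bar>lfun l z0\<bar> / Im z0" using assms by (simp add: emb_base)
  then show ?thesis using assms by (simp add: upper_def)
qed

lemma reflv_outer: "lfun l z0 \<noteq> 0 \<Longrightarrow> reflv (outer z0 l) v = reflv (lvec z0 l) v"
  by (simp add: reflv_def outer_def sgn_if)

text \<open>Disjointness excludes products strictly between -1 and 1. With a product at least 1,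
  \<open>a - b\<close> would be causal, hence of constant sign on the sheet; but it is positive at a
  point of \<open>l\<close> and negative at one of \<open>l'\<close>, because both lines bound the
  component of \<open>z0\<close>.\<close>

lemma disjoint_lines_gram:
  assumes z0: "z0 \<in> upper" and l: "valid_line l" "valid_line l'" and dis: "cond_disjoint l l' z0"
  shows "lor (outer z0 l) (outer z0 l') \<le> -1"
proof (rule ccontr)
  assume gt: "\<not> lor (outer z0 l) (outer z0 l') \<le> -1"
  define a b where "a = outer z0 l" and "b = outer z0 l'"
  from dis obtain C where C: "C \<in> components (upper - (line_set l \<union> line_set l'))" "z0 \<in> C"
      "line_set l \<subseteq> frontier C" "line_set l' \<subseteq> frontier C"
    and empty: "line_set l \<inter> line_set l' = {}" by (auto simp: cond_disjoint_def)
  have Csub: "connected C" "C \<subseteq> upper - (line_set l \<union> line_set l')"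
    using in_components_connected[OF C(1)] in_components_subset[OF C(1)] by auto
  have nz: "lfun l z0 \<noteq> 0" "lfun l' z0 \<noteq> 0"
    using C(2) Csub(2) line_set_eq l by auto
  have aa: "lor a a = 1" "lor b b = 1" using z0 l nz by (auto simp: a_def b_def lor_outer_self)
  have ab: "lor a b \<ge> 1"
  proof (rule ccontr)
    assume "\<not> lor a b \<ge> 1"
    then have "\<bar>lor a b\<bar> < 1" using gt by (auto simp: a_def b_def)
    moreover have "\<bar>lor a b\<bar> = \<bar>lor (lvec z0 l) (lvec z0 l')\<bar>"
      using nz by (simp add: a_def b_def outer_def sgn_if abs_mult)
    ultimately show False using lines_intersect[OF z0 l] empty by simp
  qed
  \<comment> \<open>The weak inequality passes to the closure of \<open>C\<close>; it is strict at
    points off the line.\<close>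
  have sign: "lor (outer z0 k) (emb z0 p) < 0"
    if k: "valid_line k" "line_set k \<subseteq> line_set l \<union> line_set l'" and p: "p \<in> frontier C" "p \<in> upper" "p \<notin> line_set k"
    for k p
  proof -
    have "C \<subseteq> {z. 0 \<le> sgn (lfun k z0) * lfun k z}"
      using component_same_sign[OF k Csub C(2)] by (auto intro: less_imp_le)
    moreover have "closed {z. 0 \<le> sgn (lfun k z0) * lfun k z}"
      by (intro closed_Collect_le continuous_intros continuous_lfun)
    ultimately have "closure C \<subseteq> {z. 0 \<le> sgn (lfun k z0) * lfun k z}" by (rule closure_minimal)
    then have "0 \<le> sgn (lfun k z0) * lfun k p" using p(1) by (auto simp: frontier_def)
    moreover have "lfun k p \<noteq> 0" using p line_set_eq[OF k(1)] by auto
    moreover have "lfun k z0 \<noteq> 0" using C(2) Csub(2) line_set_eq[OF k(1)] k(2) by auto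
    ultimately have "0 < sgn (lfun k z0) * lfun k p" by (simp add: less_le sgn_zero_iff)
    then show ?thesis using p(2) z0 k(1) by (simp add: lor_outer_emb upper_def)
  qed
  obtain p p' where p: "p \<in> line_set l" and p': "p' \<in> line_set l'" using line_set_nonempty l by blast
  have up: "p \<in> upper" "p' \<in> upper" "lfun l p = 0" "lfun l' p' = 0" using p p' line_set_eq l by auto
  define d where "d = a - b"
  have dp: "lor d (emb z0 p) > 0"
  proof -
    have "lor b (emb z0 p) < 0" unfolding b_def using p up C(3) l empty by (intro sign) auto
    moreover have "lor a (emb z0 p) = 0" unfolding a_def using z0 l up by (simp add: lor_outer_emb)
    ultimately show ?thesis by (simp add: d_def)
  qed
  have dp': "lor d (emb z0 p') < 0"
  proof -
    have "lor a (emb z0 p') < 0" unfolding a_def using p' up C(4) l empty by (intro sign) auto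
    moreover have "lor b (emb z0 p') = 0" unfolding b_def using z0 l up by (simp add: lor_outer_emb)
    ultimately show ?thesis by (simp add: d_def)
  qed
  have dd: "lor d d \<le> 0" using aa ab by (simp add: d_def lor_commute[of b a])
  \<comment> \<open>A causal vector with vanishing time coordinate is zero, which \<open>dp\<close>
    forbids.\<close>
  have "fst d \<noteq> 0"
  proof
    assume f: "fst d = 0"
    then have "snd d = 0" using dd by (simp add: lor_self)
    then show False using f dp by (simp add: lor_def)
  qed
  then show False
  proof (cases "fst d > 0")
    case True
    then have "lor d (emb z0 p) < 0" using dd up z0 by (intro lor_causal_neg lor_emb_self fst_emb_pos)
    then show False using dp by simp
  next
    case False
    then have "lor (- d) (emb z0 p') < 0"
      using dd up z0 \<open>fst d \<noteq> 0\<close> by (intro lor_causal_neg lor_emb_self fst_emb_pos) auto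
    then show False using dp' by simp
  qed
qed

text \<open>The limit is the gradient paired with the direction; the quadratic remainder, divided by
  \<open>e\<close>, still carries a factor \<open>e\<close>.\<close>

lemma lfun_directional:
  assumes "valid_line l" "p \<in> line_set l"
  shows "((\<lambda>e. lfun l (p + complex_of_real e * d) / e) \<longlongrightarrow> Re (cnj (lnormal l p) * d)) (at_right 0)"
proof (cases l)
  case (Vert x)
  have "eventually (\<lambda>e. lfun l (p + complex_of_real e * d) / e = Re (cnj (lnormal l p) * d)) (at_right 0)"
    using assms Vert by (auto simp: eventually_at_filter)
  then show ?thesis by (rule tendsto_eventually)
next
  case (Circ x r)
  then have r: "r > 0" using assms by simp
  define w where "w = p - complex_of_real x"
  have w: "(cmod w)\<^sup>2 = r\<^sup>2" using assms Circ by (simp add: w_def)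
  have ev: "eventually (\<lambda>e. Re (cnj (lnormal l p) * d) + e * ((cmod d)\<^sup>2 / (2 * r)) =
      lfun l (p + complex_of_real e * d) / e) (at_right 0)"
    unfolding eventually_at_filter
  proof (intro always_eventually allI impI)
    fix e :: real assume e: "e \<noteq> 0" "e \<in> {0<..}"
    have "(cmod (w + complex_of_real e * d))\<^sup>2 - r\<^sup>2 = 2 * e * Re (cnj w * d) + e\<^sup>2 * (cmod d)\<^sup>2"
      unfolding w[symmetric] cmod_power2 by (simp add: power2_eq_square algebra_simps)
    then have "lfun l (p + complex_of_real e * d) = (2 * e * Re (cnj w * d) + e\<^sup>2 * (cmod d)\<^sup>2) / (2 * r)"
      using Circ by (simp add: w_def algebra_simps)
    moreover have "Re (cnj (lnormal l p) * d) = Re (cnj w * d) / r"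
      using Circ r by (simp add: w_def field_simps)
    moreover have "t / r + e * (c / (2 * r)) = (2 * e * t + e\<^sup>2 * c) / (2 * r) / e" for t c
      using e r by (simp add: field_simps power2_eq_square)
    ultimately show "Re (cnj (lnormal l p) * d) + e * ((cmod d)\<^sup>2 / (2 * r)) =
      lfun l (p + complex_of_real e * d) / e"
      by (simp only:)
  qed
  have "((\<lambda>e. Re (cnj (lnormal l p) * d) + e * ((cmod d)\<^sup>2 / (2 * r))) \<longlongrightarrow>
      Re (cnj (lnormal l p) * d) + 0 * ((cmod d)\<^sup>2 / (2 * r))) (at_right 0)"
    by (intro tendsto_intros)
  then show ?thesis using Lim_transform_eventually[OF _ ev] by simp
qed

text \<open>Conformality of the half-plane: at a common point, the Lorentz product of the normals is
  the Euclidean inner product of the unit normals.\<close>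

lemma lor_lvec_lnormal:
  assumes "z0 \<in> upper" "valid_line l" "valid_line l'" "p \<in> line_set l" "p \<in> line_set l'"
  shows "lor (lvec z0 l) (lvec z0 l') = Re (cnj (lnormal l p) * lnormal l' p)"
proof -
  have sq: "(Re p - x)\<^sup>2 + (Im p)\<^sup>2 = r\<^sup>2" if "p \<in> line_set (Circ x r)" for x r
    using that cmod_sq_shift[of p x] by simp
  have CC: "(r\<^sup>2 + r'\<^sup>2 - (x - x')\<^sup>2) / (2 * r * r') = Re (cnj (lnormal (Circ x r) p) * lnormal (Circ x' r') p)"
    if "r > 0" "r' > 0" "p \<in> line_set (Circ x r)" "p \<in> line_set (Circ x' r')" for x r x' r'
  proof -
    have "r\<^sup>2 + r'\<^sup>2 - (x - x')\<^sup>2 = 2 * ((Re p - x) * (Re p - x') + Im p * Im p)"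
      unfolding sq[OF that(3), symmetric] sq[OF that(4), symmetric] by (simp add: power2_eq_square algebra_simps)
    moreover have "Re (cnj (lnormal (Circ x r) p) * lnormal (Circ x' r') p)
        = ((Re p - x) * (Re p - x') + Im p * Im p) / (r * r')"
      using that by (simp add: add_divide_distrib)
    ultimately show ?thesis using that by (simp only:) (simp add: field_simps)
  qed
  show ?thesis
  proof (cases l; cases l')
    fix x x' assume "l = Vert x" "l' = Vert x'"
    then show ?thesis using assms by (simp add: lor_lvec del: lvec.simps)
  next
    fix x x' r assume "l = Vert x" "l' = Circ x' r"
    then show ?thesis using assms by (simp add: lor_lvec del: lvec.simps)
  next
    fix x x' r assume "l = Circ x' r" "l' = Vert x"
    then show ?thesis using assms
      by (simp add: lor_lvec lor_commute[of "lvec z0 (Circ x' r)"] del: lvec.simps)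
  next
    fix x r x' r' assume ll: "l = Circ x r" "l' = Circ x' r'"
    then show ?thesis using assms CC[of r r' x x']
      by (simp add: lor_lvec del: lvec.simps line_set.simps lnormal.simps)
  qed
qed

lemma line_tangent_lnormal: "line_tangent l p = \<i> * lnormal l p"
  by (cases l) auto

lemma cmod_lnormal: "valid_line l \<Longrightarrow> p \<in> line_set l \<Longrightarrow> cmod (lnormal l p) = 1"
  by (cases l) (auto simp: norm_divide)

text \<open>One order of the two directions. The bisecting ray runs inside the component of
  \<open>z0\<close>, so derivatives along it determine the sign of each \<open>lfun\<close> at
  \<open>z0\<close>, and thus the orientation of both outer normals relative to \<open>d1\<close>
  and \<open>d2\<close>.\<close>

lemma angle_gram_aux:
  assumes z0: "z0 \<in> upper" and l: "valid_line l" "valid_line l'" and m: "m \<ge> 2"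
    and p: "p \<in> line_set l" "p \<in> line_set l'"
    and d1: "d1 \<in> {line_tangent l p, - line_tangent l p}"
    and d2: "d2 \<in> {line_tangent l' p, - line_tangent l' p}"
    and d: "d2 = d1 * cis (pi / real m)"
    and ev: "\<forall>\<^sub>F e in at_right 0. p + complex_of_real e * d1 * cis (pi / (2 * real m))
                 \<in> connected_component_set (upper - (line_set l \<union> line_set l')) z0"
  shows "lfun l z0 \<noteq> 0" "lfun l' z0 \<noteq> 0" "lor (outer z0 l) (outer z0 l') = - cos (pi / real m)"
proof -
  define C where "C = connected_component_set (upper - (line_set l \<union> line_set l')) z0"
  define \<theta> where "\<theta> = pi / (2 * real m)"
  define n n' where "n = lnormal l p" and "n' = lnormal l' p"
  have "\<exists>e. p + complex_of_real e * d1 * cis (pi / (2 * real m)) \<in> C"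
    using eventually_happens'[OF _ ev] by (auto simp: C_def)
  \<comment> \<open>The component of \<open>z0\<close> would be empty if \<open>z0\<close> lay on
    one of the lines.\<close>
  then have "C \<noteq> {}" by blast
  then have z0C: "z0 \<in> C" "C \<subseteq> upper - (line_set l \<union> line_set l')" "connected C"
    unfolding C_def connected_component_eq_empty
    by (simp_all add: connected_component_subset)
  show nz: "lfun l z0 \<noteq> 0" "lfun l' z0 \<noteq> 0"
    using z0C line_set_eq l by auto
  obtain s1 s2 :: real where s1: "d1 = s1 *\<^sub>R (\<i> * n)" "s1 = 1 \<or> s1 = -1" and s2: "d2 = s2 *\<^sub>R (\<i> * n')" "s2 = 1 \<or> s2 = -1"
  proof -
    have "\<exists>s1::real. d1 = s1 *\<^sub>R (\<i> * n) \<and> (s1 = 1 \<or> s1 = -1)"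
      using d1 by (auto simp: line_tangent_lnormal n_def intro: exI[of _ 1] exI[of _ "-1"])
    moreover have "\<exists>s2::real. d2 = s2 *\<^sub>R (\<i> * n') \<and> (s2 = 1 \<or> s2 = -1)"
      using d2 by (auto simp: line_tangent_lnormal n'_def intro: exI[of _ 1] exI[of _ "-1"])
    ultimately show ?thesis using that by blast
  qed
  have nn: "cnj n * n = 1" "cnj n' * n' = 1"
    using cmod_lnormal[OF l(1) p(1)] cmod_lnormal[OF l(2) p(2)]
    by (simp_all add: n_def n'_def complex_norm_square[symmetric] mult.commute)
  have \<theta>: "0 < \<theta>" "\<theta> < pi" using m by (auto simp: \<theta>_def field_simps)
  then have sin: "sin \<theta> > 0" by (rule sin_gt_zero)
  \<comment> \<open>Only the weak inequality survives the limit; \<open>sin \<theta> > 0\<close>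
    makes it decisive below.\<close>
  have dir: "sgn (lfun k z0) * Re (cnj (lnormal k p) * (d1 * cis \<theta>)) \<ge> 0"
    if k: "valid_line k" "p \<in> line_set k" "line_set k \<subseteq> line_set l \<union> line_set l'" for k
  proof (rule tendsto_lowerbound)
    show "((\<lambda>e. sgn (lfun k z0) * (lfun k (p + complex_of_real e * (d1 * cis \<theta>)) / e)) \<longlongrightarrow>
      sgn (lfun k z0) * Re (cnj (lnormal k p) * (d1 * cis \<theta>))) (at_right 0)"
      by (intro tendsto_intros lfun_directional k)
    have "\<forall>\<^sub>F e in at_right 0. e > (0::real)" by (simp add: eventually_at_right_less)
    with ev show "\<forall>\<^sub>F e in at_right 0. 0 \<le> sgn (lfun k z0) * (lfun k (p + complex_of_real e * (d1 * cis \<theta>)) / e)"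
    proof eventually_elim
      case (elim e)
      then have "p + complex_of_real e * (d1 * cis \<theta>) \<in> C" by (simp add: C_def \<theta>_def mult.assoc)
      then have "sgn (lfun k z0) * lfun k (p + complex_of_real e * (d1 * cis \<theta>)) > 0"
        using component_same_sign[OF k(1,3) z0C(3,2,1)] by blast
      then have "0 \<le> sgn (lfun k z0) * lfun k (p + complex_of_real e * (d1 * cis \<theta>)) / e"
        using elim(2) by (intro divide_nonneg_pos) auto
      then show ?case by simp
    qed
  qed simp
  have e1: "sgn (lfun l z0) = - s1"
  proof -
    have "cnj n * (d1 * cis \<theta>) = s1 *\<^sub>R ((cnj n * n) * (\<i> * cis \<theta>))"
      by (simp add: s1(1) scaleR_conv_of_real mult_ac)
    then have "Re (cnj n * (d1 * cis \<theta>)) = - s1 * sin \<theta>" by (simp add: nn)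
    then have "sgn (lfun l z0) * s1 * sin \<theta> \<le> 0" using dir[OF l(1) p(1)] by (simp only: n_def) simp
    then have "sgn (lfun l z0) * s1 \<le> 0" using sin by (simp add: mult_le_0_iff)
    then show ?thesis using s1(2) nz by (auto simp: sgn_if split: if_splits)
  qed
  have e2: "sgn (lfun l' z0) = s2"
  proof -
    \<comment> \<open>Seen from \<open>d2\<close> the bisector has angle \<open>- \<theta>\<close>,
      hence the sign opposite to that in \<open>e1\<close>.\<close>
    have "cis \<theta> = cis (pi / real m) * cis (- \<theta>)" by (simp add: cis_mult \<theta>_def field_simps)
    then have "cnj n' * (d1 * cis \<theta>) = cnj n' * (d2 * cis (- \<theta>))" by (simp add: d mult.assoc)
    also have "\<dots> = s2 *\<^sub>R ((cnj n' * n') * (\<i> * cis (- \<theta>)))"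
      by (simp add: s2(1) scaleR_conv_of_real mult_ac)
    finally have "Re (cnj n' * (d1 * cis \<theta>)) = s2 * sin \<theta>" by (simp add: nn)
    then have "0 \<le> sgn (lfun l' z0) * s2 * sin \<theta>" using dir[OF l(2) p(2)] by (simp only: n'_def) simp
    then have "0 \<le> sgn (lfun l' z0) * s2" using sin by (simp add: zero_le_mult_iff)
    then show ?thesis using s2(2) nz by (auto simp: sgn_if split: if_splits)
  qed
  have ii: "\<i> * u * (\<i> * v) = - (u * v)" for u v
    by (simp add: complex_eq_iff algebra_simps)
  have "cnj n * n' = (s1 * s2) *\<^sub>R (cnj d1 * d2)"
    using s1 s2 by (auto simp: scaleR_conv_of_real ii)
  also have "cnj d1 * d2 = (cnj n * n) * cis (pi / real m)"
  proof -
    have "cnj d1 * d1 = cnj n * n" using s1 by (auto simp: scaleR_conv_of_real ii)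
    then show ?thesis by (simp add: d flip: mult.assoc)
  qed
  finally have "Re (cnj n * n') = s1 * s2 * cos (pi / real m)" by (simp add: nn)
  then have "lor (lvec z0 l) (lvec z0 l') = s1 * s2 * cos (pi / real m)"
    using lor_lvec_lnormal[OF z0 l p] by (simp add: n_def n'_def)
  then show "lor (outer z0 l) (outer z0 l') = - cos (pi / real m)"
    using s1(2) s2(2) by (auto simp: outer_def e1 e2)
qed

lemma angle_gram:
  assumes z0: "z0 \<in> upper" and l: "valid_line l" "valid_line l'" and ang: "cond_angle l l' z0"
  shows "lfun l z0 \<noteq> 0 \<and> (\<exists>m::nat. m \<ge> 2 \<and> lor (outer z0 l) (outer z0 l') = - cos (pi / real m))"
proof -
  from ang obtain p m d1 d2 where m: "m \<ge> 2" and p: "line_set l \<inter> line_set l' = {p}"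
    and d1: "d1 \<in> {line_tangent l p, - line_tangent l p}"
    and d2: "d2 \<in> {line_tangent l' p, - line_tangent l' p}"
    and c: "(d2 = d1 * cis (pi / real m) \<and>
             (\<forall>\<^sub>F \<epsilon> in at_right 0. p + complex_of_real \<epsilon> * d1 * cis (pi / (2 * real m))
                 \<in> connected_component_set (upper - (line_set l \<union> line_set l')) z0))
        \<or> (d1 = d2 * cis (pi / real m) \<and>
             (\<forall>\<^sub>F \<epsilon> in at_right 0. p + complex_of_real \<epsilon> * d2 * cis (pi / (2 * real m))
                 \<in> connected_component_set (upper - (line_set l \<union> line_set l')) z0))"
    unfolding cond_angle_def by blast
  have pp: "p \<in> line_set l" "p \<in> line_set l'" using p by auto
  from c show ?thesis
  proof (elim disjE conjE)
    assume "d2 = d1 * cis (pi / real m)"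
      "\<forall>\<^sub>F \<epsilon> in at_right 0. p + complex_of_real \<epsilon> * d1 * cis (pi / (2 * real m))
                 \<in> connected_component_set (upper - (line_set l \<union> line_set l')) z0"
    from angle_gram_aux[OF z0 l m pp d1 d2 this] show ?thesis using m by blast
  next
    assume "d1 = d2 * cis (pi / real m)"
      "\<forall>\<^sub>F \<epsilon> in at_right 0. p + complex_of_real \<epsilon> * d2 * cis (pi / (2 * real m))
                 \<in> connected_component_set (upper - (line_set l \<union> line_set l')) z0"
    from angle_gram_aux[OF z0 l(2,1) m pp(2,1) d2 d1 this(1)] this(2) show ?thesis
      using m by (auto simp: Un_commute lor_commute)
  qed
qed

section \<open>Recovering points and boundary limits from the hyperboloid\<close>

text \<open>The null coordinates, time plus or minus one space coordinate, are simple in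
  \<open>z\<close> and let \<open>emb\<close> be inverted.\<close>

lemma emb_components:
  assumes "z0 \<in> upper" "z \<in> upper"
  shows "fst (emb z0 z) - Im (snd (emb z0 z)) = Im z0 / Im z"
    and "fst (emb z0 z) + Im (snd (emb z0 z)) = ((Re z - Re z0)\<^sup>2 + (Im z)\<^sup>2) / (Im z * Im z0)"
    and "Re (snd (emb z0 z)) = (Re z - Re z0) / Im z"
  using assms by (simp_all add: emb_def upper_def field_simps power2_eq_square)

lemma emb_inj:
  assumes "z0 \<in> upper" "z \<in> upper" "z' \<in> upper" "emb z0 z = emb z0 z'"
  shows "z = z'"
proof -
  have "Im z0 / Im z = Im z0 / Im z'" using assms emb_components(1) by metis
  then have im: "Im z = Im z'" using assms by (simp add: upper_def field_simps)
  have "(Re z - Re z0) / Im z = (Re z' - Re z0) / Im z'" using assms emb_components(3) by metis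
  then have "Re z = Re z'" using im assms by (simp add: upper_def)
  then show ?thesis using im by (simp add: complex_eq_iff)
qed

text \<open>The images of \<open>z0\<close>, of a point above it and of a point beside it form a
  basis. Hence agreement of linear maps on embedded points is full agreement.\<close>

lemma emb_spanning:
  assumes "z0 \<in> upper" "linear f" "linear g" "\<And>z. z \<in> upper \<Longrightarrow> f (emb z0 z) = g (emb z0 z)"
  shows "f = g"
proof
  fix v :: "real \<times> complex"
  define z1 z2 where "z1 = Complex (Re z0) (2 * Im z0)" and "z2 = Complex (Re z0 + Im z0) (Im z0)"
  have up: "z1 \<in> upper" "z2 \<in> upper" using assms by (auto simp: z1_def z2_def upper_def)
  have y: "Im z0 > 0" using assms by (simp add: upper_def)
  have e: "emb z0 z0 = (1, 0)" "emb z0 z1 = (5 / 4, Complex 0 (3 / 4))" "emb z0 z2 = (3 / 2, Complex 1 (1 / 2))"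
    using emb_base[OF assms(1)] y by (simp_all add: emb_def z1_def z2_def field_simps power2_eq_square)
  define c2 c1 where "c2 = Re (snd v)" and "c1 = (Im (snd v) - c2 / 2) * 4 / 3"
  define c0 where "c0 = fst v - 5 / 4 * c1 - 3 / 2 * c2"
  have "v = c0 *\<^sub>R emb z0 z0 + c1 *\<^sub>R emb z0 z1 + c2 *\<^sub>R emb z0 z2"
    by (simp add: prod_eq_iff complex_eq_iff e c0_def c1_def c2_def field_simps)
  then show "f v = g v"
    using assms(1,4) up by (simp add: linear_add[OF assms(2)] linear_add[OF assms(3)]
        linear_scale[OF assms(2)] linear_scale[OF assms(3)])
qed

text \<open>Inverting the projective coordinates expresses \<open>z k\<close> through
  \<open>h k\<close> and \<open>q k\<close>. The boundary point with \<open>Im p = 1\<close>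
  corresponds to infinity, every other one to a real number.\<close>

lemma emb_boundary_limit:
  fixes z :: "nat \<Rightarrow> complex"
  assumes z0: "z0 \<in> upper" and z: "\<And>k. z k \<in> upper"
    and top: "filterlim (\<lambda>k. fst (emb z0 (z k))) at_top sequentially"
    and lim: "(\<lambda>k. snd (emb z0 (z k)) /\<^sub>R fst (emb z0 (z k))) \<longlonglongrightarrow> p" and p: "norm p = 1"
  shows "(\<exists>\<zeta>::real. z \<longlonglongrightarrow> complex_of_real \<zeta>) \<or> filterlim z at_infinity sequentially"
proof -
  define y0 where "y0 = Im z0"
  define h where "h k = fst (emb z0 (z k))" for k
  define q where "q k = snd (emb z0 (z k)) /\<^sub>R h k" for k
  have y0: "y0 > 0" using z0 by (simp add: y0_def upper_def)
  have y: "Im (z k) > 0" for k using z[of k] by (simp add: upper_def)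
  have h: "h k > 0" for k using fst_emb_pos[OF z0 z] by (simp add: h_def)
  have q: "q \<longlonglongrightarrow> p" using lim by (simp add: q_def[abs_def] h_def)
  have ih: "(\<lambda>k. 1 / h k) \<longlonglongrightarrow> 0"
    using tendsto_inverse_0_at_top[OF top] by (simp add: h_def inverse_eq_divide)
  have qh: "snd (emb z0 (z k)) = h k *\<^sub>R q k" for k using h[of k] by (simp add: q_def)
  have c1: "h k * (1 - Im (q k)) = y0 / Im (z k)" for k
    using emb_components(1)[OF z0 z[of k]] by (simp add: qh h_def[symmetric] y0_def algebra_simps)
  have c2: "h k * (1 + Im (q k)) = ((Re (z k) - Re z0)\<^sup>2 + (Im (z k))\<^sup>2) / (Im (z k) * y0)" for k
    using emb_components(2)[OF z0 z[of k]] by (simp add: qh h_def[symmetric] y0_def algebra_simps)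
  have c3: "h k * Re (q k) = (Re (z k) - Re z0) / Im (z k)" for k
    using emb_components(3)[OF z0 z[of k]] by (simp add: qh)
  have pos: "1 - Im (q k) > 0" for k
  proof -
    have "h k * (1 - Im (q k)) > 0" unfolding c1 using y0 y[of k] by simp
    then show ?thesis using h[of k] by (simp add: zero_less_mult_iff)
  qed
  have im: "Im (z k) = y0 * (1 / h k) / (1 - Im (q k))" for k
    using c1[of k] h[of k] y[of k] pos[of k] by (simp add: field_simps)
  have re: "Re (z k) = Re z0 + y0 * Re (q k) / (1 - Im (q k))" for k
  proof -
    have "Re (z k) - Re z0 = h k * Re (q k) * Im (z k)" using c3[of k] y[of k] by (simp add: field_simps)
    also have "\<dots> = y0 * Re (q k) / (1 - Im (q k))" using h[of k] by (simp add: im)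
    finally show ?thesis by simp
  qed
  show ?thesis
  proof (cases "Im p = 1")
    case False
    have "(\<lambda>k. Im (z k)) \<longlonglongrightarrow> y0 * 0 / (1 - Im p)"
      unfolding im by (intro tendsto_intros ih q) (use False in auto)
    moreover have "(\<lambda>k. Re (z k)) \<longlonglongrightarrow> Re z0 + y0 * Re p / (1 - Im p)"
      unfolding re by (intro tendsto_intros q) (use False in auto)
    ultimately have "z \<longlonglongrightarrow> complex_of_real (Re z0 + y0 * Re p / (1 - Im p))"
      by (auto simp: tendsto_complex_iff)
    then show ?thesis by blast
  next
    case True
    \<comment> \<open>With \<open>1 - Im (q k)\<close> tending to 0 the formula for
      \<open>Re\<close> may be indeterminate; the distance to \<open>Re z0\<close> still
      diverges.\<close>
    have sq: "(cmod (z k - complex_of_real (Re z0)))\<^sup>2 = y0\<^sup>2 * (1 + Im (q k)) / (1 - Im (q k))" for k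
    proof -
      have "h k * (1 + Im (q k)) * (Im (z k) * y0) = (Re (z k) - Re z0)\<^sup>2 + (Im (z k))\<^sup>2"
        using c2[of k] y[of k] y0 by (simp add: field_simps)
      moreover have "h k * (1 + Im (q k)) * (Im (z k) * y0) = y0\<^sup>2 * (1 + Im (q k)) / (1 - Im (q k))"
        using h[of k] by (simp add: im power2_eq_square)
      ultimately show ?thesis by (simp add: cmod_sq_shift)
    qed
    have num: "(\<lambda>k. y0\<^sup>2 * (1 + Im (q k))) \<longlonglongrightarrow> y0\<^sup>2 * (1 + 1)"
      using True by (intro tendsto_intros) (metis q tendsto_Im)
    have "(\<lambda>k. 1 - Im (q k)) \<longlonglongrightarrow> 1 - 1"
      using True by (intro tendsto_intros) (metis q tendsto_Im)
    then have "filterlim (\<lambda>k. 1 - Im (q k)) (at_right 0) sequentially"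
      using pos less_imp_neq[OF pos] by (auto simp: filterlim_at intro!: always_eventually)
    then have "filterlim (\<lambda>k. y0\<^sup>2 * (1 + Im (q k)) * inverse (1 - Im (q k))) at_top sequentially"
      using y0 by (intro filterlim_tendsto_pos_mult_at_top[OF num] filterlim_compose[OF filterlim_inverse_at_top_right]) auto
    then have "filterlim (\<lambda>k. (cmod (z k - complex_of_real (Re z0)))\<^sup>2) at_top sequentially"
      by (simp add: sq divide_inverse)
    then have "filterlim (\<lambda>k. sqrt ((cmod (z k - complex_of_real (Re z0)))\<^sup>2)) at_top sequentially"
      by (rule filterlim_compose[OF sqrt_at_top])
    then have "filterlim (\<lambda>k. cmod (z k - complex_of_real (Re z0))) at_top sequentially" by simp
    then have "filterlim (\<lambda>k. z k - complex_of_real (Re z0)) at_infinity sequentially"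
      by (rule filterlim_norm_at_top_imp_at_infinity)
    then have "filterlim (\<lambda>k. complex_of_real (Re z0) + (z k - complex_of_real (Re z0))) at_infinity sequentially"
      by (intro tendsto_add_filterlim_at_infinity[OF tendsto_const])
    then show ?thesis by simp
  qed
qed

section \<open>The random process\<close>

lemma AE_index_space_range: "AE x in index_space. \<forall>m. x m \<in> {1,2,3}"
proof -
  have "AE x in index_space. x m \<in> {1,2,3}" for m
    unfolding index_space_def
    by (rule AE_PiM_component) (auto simp: measure_pmf.prob_space_axioms AE_measure_pmf_iff)
  then show ?thesis by (simp add: AE_all_countable)
qed

text \<open>Avoiding \<open>i\<close> during \<open>n\<close> given steps has probability
  \<open>(2 / 3) ^ n\<close>, so avoiding it forever after \<open>N\<close> is a null event.\<close>

lemma AE_index_space_recurrent: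
  assumes i: "i \<in> {1,2,3::nat}"
  shows "AE x in index_space. \<forall>N. \<exists>m\<ge>N. x m = i"
proof -
  interpret P: product_prob_space "\<lambda>_::nat. measure_pmf (pmf_of_set {1,2,3::nat})" UNIV
    by unfold_locales
  have sp: "space index_space = UNIV" by (simp add: index_space_def space_PiM)
  have meas: "{x. \<forall>m\<in>J. x m \<noteq> i} \<in> sets index_space" for J
  proof -
    have "{x \<in> space index_space. x m \<in> - {i}} \<in> sets index_space" for m
    proof -
      have "(\<lambda>x. x m) \<in> index_space \<rightarrow>\<^sub>M measure_pmf (pmf_of_set {1,2,3::nat})"
        unfolding index_space_def by (rule measurable_component_singleton) simp
      from measurable_sets[OF this, of "- {i}"] show ?thesis by (simp add: vimage_def sp)
    qed
    then have "{x \<in> space index_space. \<forall>m\<in>J. x m \<in> - {i}} \<in> sets index_space"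
      by (intro sets.sets_Collect_countable_Ball) auto
    then show ?thesis by (simp add: sp)
  qed
  have two_thirds: "measure_pmf.prob (pmf_of_set {1,2,3::nat}) (- {i}) = 2 / 3"
  proof -
    have "{1,2,3} \<inter> - {i} = {1,2,3} - {i}" by auto
    then have "card ({1,2,3} \<inter> - {i}) = 2" using i by simp
    then show ?thesis by (simp add: measure_pmf_of_set)
  qed
  have "AE x in index_space. \<exists>m\<ge>N. x m = i" for N
  proof (rule AE_I)
    show "{x \<in> space index_space. \<not> (\<exists>m\<ge>N. x m = i)} \<subseteq> {x. \<forall>m\<in>{N..}. x m \<noteq> i}" by auto
    show "{x. \<forall>m\<in>{N..}. x m \<noteq> i} \<in> sets index_space" by (rule meas)
    have le: "measure index_space {x. \<forall>m\<in>{N..}. x m \<noteq> i} \<le> (2 / 3) ^ n" for n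
    proof -
      have "measure index_space {x. \<forall>m\<in>{N..}. x m \<noteq> i} \<le> measure index_space {x. \<forall>m\<in>{N..<N+n}. x m \<noteq> i}"
        using meas unfolding index_space_def by (intro P.finite_measure_mono) auto
      \<comment> \<open>A finite window makes the event a cylinder, whose measure is a
        product.\<close>
      also have "{x. \<forall>m\<in>{N..<N+n}. x m \<noteq> i} = P.emb UNIV {N..<N+n} (Pi\<^sub>E {N..<N+n} (\<lambda>_. - {i}))"
        by (auto simp: prod_emb_def PiE_def Pi_def extensional_def)
      also have "measure index_space \<dots> = (\<Prod>m\<in>{N..<N+n}. 2 / 3)"
        unfolding index_space_def by (subst P.measure_PiM_emb) (auto simp only: two_thirds finite_atLeastLessThan sets_measure_pmf)
      finally show ?thesis by simp
    qed
    have "(\<lambda>n. (2 / 3 :: real) ^ n) \<longlonglongrightarrow> 0" by (rule LIMSEQ_realpow_zero) auto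
    then have "measure index_space {x. \<forall>m\<in>{N..}. x m \<noteq> i} \<le> 0"
      by (rule LIMSEQ_le_const) (use le in auto)
    then have "measure index_space {x. \<forall>m\<in>{N..}. x m \<noteq> i} = 0" by (simp add: measure_le_0_iff)
    then show "emeasure index_space {x. \<forall>m\<in>{N..}. x m \<noteq> i} = 0"
      unfolding index_space_def P.emeasure_eq_measure by simp
  qed
  then show ?thesis by (simp add: AE_all_countable)
qed

section \<open>The Demazure process of the three reflections\<close>

locale three_mirrors =
  fixes L :: "nat \<Rightarrow> hline" and z0 :: complex
  assumes valid: "\<forall>k \<in> {1,2,3::nat}. valid_line (L k)"
    and z0: "z0 \<in> upper"
    and pairs: "\<forall>i \<in> {1,2,3::nat}. \<forall>i' \<in> {1,2,3::nat}. i \<noteq> i' \<longrightarrow>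
           cond_disjoint (L i) (L i') z0 \<or> cond_angle (L i) (L i') z0"
begin

definition root :: "nat \<Rightarrow> real \<times> complex" where
  "root i = outer z0 (L i)"

lemma lfun_base_nonzero:
  assumes i: "i \<in> {1,2,3}"
  shows "lfun (L i) z0 \<noteq> 0"
proof -
  obtain j where j: "j \<in> {1,2,3}" "i \<noteq> j"
  proof (cases "i = 1")
    case True then show ?thesis using that[of 2] by simp
  next
    case False then show ?thesis using that[of 1] by simp
  qed
  with pairs i consider "cond_disjoint (L i) (L j) z0" | "cond_angle (L i) (L j) z0" by blast
  then show ?thesis
  proof cases
    case 1
    then have "z0 \<notin> line_set (L i)"
      using in_components_subset by (fastforce simp: cond_disjoint_def)
    then show ?thesis using line_set_eq[of "L i"] valid i z0 by auto
  next
    case 2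
    then show ?thesis using angle_gram[OF z0] valid i j by blast
  qed
qed

sublocale chamber root "{1,2,3}"
proof
  show "lor (root i) (root i) = 1" if "i \<in> {1,2,3}" for i
    using that valid z0 lfun_base_nonzero[OF that] by (auto simp: root_def intro!: lor_outer_self)
  show "fst (root i) > 0" if "i \<in> {1,2,3}" for i
    using that valid z0 lfun_base_nonzero[OF that] by (auto simp: root_def intro!: fst_outer_pos)
  show "lor (root i) (root j) \<le> -1 \<or> (\<exists>m::nat. m \<ge> 2 \<and> lor (root i) (root j) = - cos (pi / real m))"
    if "i \<in> {1,2,3}" "j \<in> {1,2,3}" "i \<noteq> j" for i j
  proof -
    have v: "valid_line (L i)" "valid_line (L j)" using valid that by auto
    from pairs that consider "cond_disjoint (L i) (L j) z0" | "cond_angle (L i) (L j) z0" by blast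
    then show ?thesis
      using disjoint_lines_gram[OF z0 v] angle_gram[OF z0 v] unfolding root_def by cases blast+
  qed
qed simp

lemma emb_act:
  assumes "set w \<subseteq> {1,2,3}" "z \<in> upper"
  shows "act L w z \<in> upper" "emb z0 (act L w z) = wact root w (emb z0 z)"
proof -
  have "act L w z \<in> upper \<and> emb z0 (act L w z) = wact root w (emb z0 z)"
    using assms(1)
  proof (induction w)
    case (Cons a w)
    then have a: "a \<in> {1,2,3}" "valid_line (L a)" using valid by auto
    then show ?case
      using Cons z0 lfun_base_nonzero[OF a(1)]
      by (auto simp: refl_upper emb_refl root_def reflv_outer)
  qed (simp add: assms)
  then show "act L w z \<in> upper" "emb z0 (act L w z) = wact root w (emb z0 z)" by auto
qed

text \<open>The embedding is injective and its image spans, so the action on the half-plane and the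
  linear action identify the same words.\<close>

lemma same_elem_iff:
  assumes "set w \<subseteq> {1,2,3}" "set w' \<subseteq> {1,2,3}"
  shows "same_elem L w w' \<longleftrightarrow> wact root w = wact root w'"
proof
  assume se: "same_elem L w w'"
  show "wact root w = wact root w'"
  proof (rule emb_spanning[OF z0 wact_linear wact_linear])
    fix z assume "z \<in> upper"
    then show "wact root w (emb z0 z) = wact root w' (emb z0 z)"
      using se emb_act(2)[OF assms(1)] emb_act(2)[OF assms(2)] by (simp add: same_elem_def flip: emb_act(2))
  qed
next
  assume eq: "wact root w = wact root w'"
  show "same_elem L w w'"
    unfolding same_elem_def
  proof
    fix z assume "z \<in> upper"
    then show "act L w z = act L w' z"
      using emb_act assms eq by (intro emb_inj[OF z0]) auto
  qed
qed

lemma wlen_eq_len: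
  assumes "set w \<subseteq> {1,2,3}"
  shows "wlen L w = len w"
proof -
  have "(\<exists>w'. set w' \<subseteq> {1,2,3} \<and> length w' = n \<and> same_elem L w' w) \<longleftrightarrow>
      (\<exists>w'. set w' \<subseteq> {1,2,3} \<and> length w' = n \<and> wact root w' = wact root w)" for n
    using same_elem_iff[OF _ assms] by blast
  then show ?thesis unfolding wlen_def len_def by simp
qed

context
  fixes idx :: "nat \<Rightarrow> nat"
  assumes idx: "\<And>m. idx m \<in> {1,2,3}"
begin

lemma demazure_set: "set (demazure L idx m) \<subseteq> {1,2,3}"
proof (induction m)
  case (Suc m)
  then show ?case using idx[of "Suc m"] by auto
qed simp

lemma demazure_step:
  "demazure L idx (Suc m) =
    (if len (demazure L idx m @ [idx (Suc m)]) > len (demazure L idx m)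
     then demazure L idx m @ [idx (Suc m)] else demazure L idx m)"
proof -
  have "set (demazure L idx m @ [idx (Suc m)]) \<subseteq> {1,2,3}" using demazure_set idx by auto
  then show ?thesis using demazure_set by (simp add: wlen_eq_len)
qed

lemma demazure_reduced: "len (demazure L idx m) = length (demazure L idx m)"
proof (induction m)
  case 0
  show ?case using len_le_length[of "[]"] by simp
next
  case (Suc m)
  have "set (demazure L idx m @ [idx (Suc m)]) \<subseteq> {1,2,3}" using demazure_set idx by auto
  from len_le_length[OF this] show ?case using Suc unfolding demazure_step by auto
qed

lemma demazure_prefix: "m \<le> m' \<Longrightarrow> \<exists>y. demazure L idx m' = demazure L idx m @ y"
  by (induction rule: dec_induct) (auto simp: demazure_step)

text \<open>Both words are reduced and one is a prefix of the other, so equal elements have words of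
  equal length.\<close>

lemma demazure_same_elem_iff:
  assumes "m \<le> m'"
  shows "same_elem L (demazure L idx m') (demazure L idx m) \<longleftrightarrow> demazure L idx m' = demazure L idx m"
proof
  assume "same_elem L (demazure L idx m') (demazure L idx m)"
  then have "wact root (demazure L idx m') = wact root (demazure L idx m)"
    using same_elem_iff demazure_set by blast
  then have "len (demazure L idx m') = len (demazure L idx m)" by (rule len_cong)
  then have "length (demazure L idx m') = length (demazure L idx m)" by (simp only: demazure_reduced)
  then show "demazure L idx m' = demazure L idx m" using demazure_prefix[OF assms] by auto
qed (simp add: same_elem_def)

lemma recurrent_not_eventually_const:
  assumes rec: "\<And>i N. i \<in> {1,2,3} \<Longrightarrow> \<exists>m\<ge>N. idx m = i"
  shows "\<not> eventually_const_elem L (demazure L idx)"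
proof
  assume "eventually_const_elem L (demazure L idx)"
  then obtain N where N: "\<And>m. m \<ge> N \<Longrightarrow> demazure L idx m = demazure L idx N"
    by (auto simp: eventually_const_elem_def demazure_same_elem_iff)
  obtain i where i: "i \<in> {1,2,3}" "len (demazure L idx N @ [i]) > len (demazure L idx N)"
    using not_all_descents[OF _ demazure_set] by auto
  \<comment> \<open>Step \<open>k\<close> to \<open>Suc k\<close> reads \<open>idx (Suc k)\<close>,
    so the draw must come at \<open>Suc N\<close> or later to act on the word reached at time
    \<open>N\<close>.\<close>
  obtain m where m: "m \<ge> Suc N" "idx m = i" using rec[OF i(1)] by blast
  then obtain k where k: "m = Suc k" "k \<ge> N" by (cases m) auto
  have "demazure L idx m = demazure L idx N @ [i]"
    using demazure_step[of k] N[of k] i k m by simp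
  then show False using N[of m] m by simp
qed

lemma not_eventually_const_limit:
  assumes nc: "\<not> eventually_const_elem L (demazure L idx)"
  shows "(\<exists>\<zeta>::real. (\<lambda>m. act L (demazure L idx m) z0) \<longlonglongrightarrow> complex_of_real \<zeta>)
          \<or> filterlim (\<lambda>m. act L (demazure L idx m) z0) at_infinity sequentially"
proof -
  define u where "u = demazure L idx"
  have setu: "set (u m) \<subseteq> {1,2,3}" for m using demazure_set by (simp add: u_def)
  have long: "\<exists>m. length (u m) \<ge> n" for n
  proof (induction n)
    case (Suc n)
    then obtain m where m: "length (u m) \<ge> n" by blast
    obtain m' where m': "m' \<ge> m" "u m' \<noteq> u m"
      using nc demazure_same_elem_iff unfolding eventually_const_elem_def u_def by blast
    obtain y where "u m' = u m @ y" using demazure_prefix[OF m'(1)] by (auto simp: u_def)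
    then have "length (u m') \<ge> Suc n" using m m'(2) by (cases y) auto
    then show ?case by blast
  qed simp
  have nth_eq: "u m ! k = u m' ! k" if "k < length (u m)" "k < length (u m')" for m m' k
  proof -
    have "\<exists>y. u m' = u m @ y \<or> u m = u m' @ y"
      using demazure_prefix[of m m'] demazure_prefix[of m' m] unfolding u_def by (cases "m \<le> m'") auto
    then show ?thesis using that by (auto simp: nth_append)
  qed
  \<comment> \<open>The words extend one another, so they define one infinite word; by
    \<open>a_eq\<close> the choice of \<open>m\<close> does not matter.\<close>
  define a where "a k = u (SOME m. length (u m) > k) ! k" for k
  have a_eq: "a k = u m ! k" if "k < length (u m)" for k m
  proof -
    have "length (u (SOME m. length (u m) > k)) > k" by (rule someI[of _ m]) (rule that)
    then show ?thesis unfolding a_def using nth_eq that by blast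
  qed
  have take_eq: "map a [0..<k] = take k (u m)" if "k \<le> length (u m)" for k m
    using that a_eq by (intro nth_equalityI) auto
  have aI: "a k \<in> {1,2,3}" for k
  proof -
    obtain m where "length (u m) \<ge> Suc k" using long by blast
    then have "a k \<in> set (u m)" using a_eq[of k m] by simp
    then show ?thesis using setu by blast
  qed
  \<comment> \<open>A prefix of a reduced word is reduced, by subadditivity of length.\<close>
  have red: "len (map a [0..<k]) = k" for k
  proof -
    obtain m where m: "length (u m) \<ge> k" using long by blast
    have sub: "set (take k (u m)) \<subseteq> {1,2,3}" "set (drop k (u m)) \<subseteq> {1,2,3}"
      using setu[of m] set_take_subset[of k "u m"] set_drop_subset[of k "u m"] by blast+
    have "length (u m) = len (take k (u m) @ drop k (u m))"
      using demazure_reduced by (simp add: u_def)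
    also have "\<dots> \<le> len (take k (u m)) + length (drop k (u m))"
      using len_append_le[OF sub] len_le_length[OF sub(2)] by linarith
    finally have "k \<le> len (take k (u m))" using m by simp
    then show ?thesis using len_le_length[OF sub(1)] m take_eq[OF m] by simp
  qed
  define v where "v k = wact root (map a [0..<k]) (1, 0)" for k
  have top: "filterlim (\<lambda>k. fst (v k)) at_top sequentially"
    and "\<exists>p. norm p = 1 \<and> (\<lambda>k. snd (v k) /\<^sub>R fst (v k)) \<longlonglongrightarrow> p"
    using reduced_orbit_convergent[of a, OF aI red] unfolding v_def by auto
  then obtain p where p: "norm p = 1" "(\<lambda>k. snd (v k) /\<^sub>R fst (v k)) \<longlonglongrightarrow> p" by blast
  have len_top: "filterlim (\<lambda>m. length (u m)) at_top sequentially"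
    unfolding filterlim_at_top
  proof
    fix n
    obtain M where M: "length (u M) \<ge> n" using long by blast
    have "length (u m) \<ge> n" if "m \<ge> M" for m
      using demazure_prefix[OF that] M by (auto simp: u_def)
    then show "\<forall>\<^sub>F m in sequentially. n \<le> length (u m)" by (auto simp: eventually_sequentially)
  qed
  \<comment> \<open>The process runs along the infinite reduced word, pausing whenever a letter is
    rejected; its limits follow since \<open>length (u m)\<close> tends to infinity.\<close>
  have ev: "emb z0 (act L (u m) z0) = v (length (u m))" for m
    using emb_act(2)[OF setu z0] take_eq[of "length (u m)" m] by (simp add: v_def emb_base z0)
  show ?thesis
    unfolding u_def[symmetric]
  proof (rule emb_boundary_limit[OF z0 _ _ _ p(1)])
    show "act L (u m) z0 \<in> upper" for m using emb_act(1)[OF setu z0] .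
    show "filterlim (\<lambda>k. fst (emb z0 (act L (u k) z0))) at_top sequentially"
      unfolding ev by (rule filterlim_compose[OF top len_top])
    show "(\<lambda>k. snd (emb z0 (act L (u k) z0)) /\<^sub>R fst (emb z0 (act L (u k) z0))) \<longlonglongrightarrow> p"
      unfolding ev by (rule filterlim_compose[OF p(2) len_top])
  qed
qed

end

end

theorem mainTheorem2:
  fixes L :: "nat \<Rightarrow> hline" and z0 :: complex
  assumes "\<forall>k \<in> {1,2,3::nat}. valid_line (L k)"
    and "z0 \<in> upper"
    and "\<forall>i \<in> {1,2,3::nat}. \<forall>i' \<in> {1,2,3::nat}. i \<noteq> i' \<longrightarrow>
           cond_disjoint (L i) (L i') z0 \<or> cond_angle (L i) (L i') z0"
  shows "(AE idx in index_space. \<not> eventually_const_elem L (demazure L idx))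
    \<and> (\<forall>idx. (\<forall>m. idx m \<in> {1,2,3}) \<longrightarrow> \<not> eventually_const_elem L (demazure L idx) \<longrightarrow>
         ((\<exists>\<zeta>::real. (\<lambda>m. act L (demazure L idx m) z0) \<longlonglongrightarrow> complex_of_real \<zeta>)
          \<or> filterlim (\<lambda>m. act L (demazure L idx m) z0) at_infinity sequentially))"
proof -
  interpret three_mirrors L z0 using assms by unfold_locales
  have "AE idx in index_space. \<forall>i\<in>{1,2,3}. \<forall>N. \<exists>m\<ge>N. idx m = i"
    by (intro AE_finite_allI AE_index_space_recurrent) auto
  with AE_index_space_range have "AE idx in index_space. \<not> eventually_const_elem L (demazure L idx)"
  proof eventually_elim
    case (elim idx)
    then show ?case by (intro recurrent_not_eventually_const) auto
  qed
  then show ?thesis using not_eventually_const_limit by blast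
qed

end
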